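(* Let $A\subset\mathbb{R}^d$ be a set of positive reach. Then the set of all smooth points $S:=S_0(A)\cup S_1(A)\cup\dots\cup S_d(A)$ is open and dense in $A$.
   Context: For nonempty $A\subset\mathbb{R}^d$, $\operatorname{Unp}A$ is the set of all $z\in\mathbb{R}^d$ for which there is exactly one $a\in A$ with $|z-a|=\operatorname{dist}(z,A)$. For $a\in A$, $\operatorname{reach}(A,a):=\sup\{r\ge 0: B(a,r)\subset\operatorname{Unp}A\}$, where $B(a,r)$ is the open ball and $B(a,0):=\emptyset$; $\operatorname{reach}A:=\inf_{a\in A}\operatorname{reach}(A,a)$. $A$ has positive reach if $\operatorname{reach}A>0$. A mapping is $C^{1,1}$ if it is Fréchet differentiable with Lipschitz derivative. For $0<k<d$, a nonempty set $M\subset\mathbb{R}^d$ is a $k$-dimensional $C^{1,1}$ manifold if for each $a\in M$ there exist a $k$-dimensional linear subspace $W\subset\mathbb{R}^d$, an open ball $U$ in $W$ and a $C^{1,1}$ mapping $\varphi:U\to W^\perp$ such that $P:=\{w+\varphi(w):w\in U\}$ is a relatively open subset of $M$ and $a\in P$. A $d$-dimensional $C^{1,1}$ manifold in $\mathbb{R}^d$ is a nonempty open set; a $0$-dimensional one is an isolated set (all its points are isolated). For $0\le k\le d$, $S_k(A)$ is the set of points $a\in A$ such that $A\cap B(a,r)$ is a $k$-dimensional $C^{1,1}$ manifold for some $r>0$. *)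

theory Defs
  imports "HOL-Analysis.Analysis"
begin

definition Unp :: "'a::euclidean_space set \<Rightarrow> 'a set" where
  "Unp A = {z. \<exists>!a. a \<in> A \<and> dist z a = infdist z A}"

text \<open>The reach may be infinite, hence \<^typ>\<open>ereal\<close>. The radius \<open>r = 0\<close> is always admissible,
  since \<^term>\<open>ball a 0 = {}\<close>.\<close>

definition reach_at :: "'a::euclidean_space set \<Rightarrow> 'a \<Rightarrow> ereal" where
  "reach_at A a = Sup {ereal r | r. 0 \<le> r \<and> ball a r \<subseteq> Unp A}"

definition reach :: "'a::euclidean_space set \<Rightarrow> ereal" where
  "reach A = (INF a\<in>A. reach_at A a)"

definition positive_reach :: "'a::euclidean_space set \<Rightarrow> bool" where
  "positive_reach A \<longleftrightarrow> A \<noteq> {} \<and> 0 < reach A"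

text \<open>For \<open>U\<close> relatively open in the subspace \<open>W\<close>, the Frechet derivative of \<open>f\<close> at \<open>u\<close> is a linear
  map on \<open>W\<close>. It is represented by a linear map \<open>f' u\<close> on the whole space, of which only the
  restriction to \<open>W\<close> is determined; so the Lipschitz condition uses the operator norm
  on \<open>W\<close> only.\<close>

definition C11_on :: "'a::euclidean_space set \<Rightarrow> 'a set \<Rightarrow> ('a \<Rightarrow> 'a) \<Rightarrow> bool" where
  "C11_on W U f \<longleftrightarrow>
     (\<exists>f'. (\<forall>u\<in>U. (f has_derivative f' u) (at u within U)) \<and>
       (\<exists>L\<ge>0. \<forall>u\<in>U. \<forall>v\<in>U. \<forall>w\<in>W. norm (f' u w - f' v w) \<le> L * dist u v * norm w))"

definition C11_manifold :: "nat \<Rightarrow> 'a::euclidean_space set \<Rightarrow> bool" where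
  "C11_manifold k M \<longleftrightarrow>
     (if k = 0 then discrete M
      else if k = DIM('a) then M \<noteq> {} \<and> open M
      else M \<noteq> {} \<and>
        (\<forall>a\<in>M. \<exists>W c r \<phi>.
           subspace W \<and> dim W = k \<and> c \<in> W \<and> 0 < r \<and>
           (\<forall>w \<in> W \<inter> ball c r. \<phi> w \<in> W\<^sup>\<bottom>) \<and>
           C11_on W (W \<inter> ball c r) \<phi> \<and>
           openin (top_of_set M) ((\<lambda>w. w + \<phi> w) ` (W \<inter> ball c r)) \<and>
           a \<in> (\<lambda>w. w + \<phi> w) ` (W \<inter> ball c r)))"

definition smooth_points :: "nat \<Rightarrow> 'a::euclidean_space set \<Rightarrow> 'a set" where
  "smooth_points k A = {a \<in> A. \<exists>r>0. C11_manifold k (A \<inter> ball a r)}"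

end

theory Submission
  imports Defs
begin

text \<open>If every point at distance less than \<open>R\<close> from \<open>A\<close> has a unique nearest point in \<open>A\<close>, then a
  proximal normal \<open>v\<close> of \<open>A\<close> at \<open>a\<close> satisfies \<open>v \<bullet> (b - a) \<le> |v| |b - a|\<^sup>2 / R\<close> for all \<open>b \<in> A\<close>. Hence the
  cones of normals are convex and vary upper semicontinuously, \<open>A\<close> stays quadratically close to its
  tangent cones (the polars), and all tangent vectors are realized by points of \<open>A\<close>.
  Near a point whose tangent cone has locally maximal dimension, after a small move into the relative
  interior of that cone, all tangent cones are linear spaces close to a fixed space \<open>L\<close>. There \<open>A\<close>
  projects injectively onto an open part of \<open>L\<close>, hence is a graph over it, and the quadratic closeness to
  the tangent spaces makes the graph \<open>C\<^sup>1\<^sup>,\<^sup>1\<close>.\<close>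

section \<open>Normal and tangent cones\<close>

text \<open>Proximal normals. \<open>K\<close> may depend on \<open>v\<close>, which makes sums and
  multiples trivial; a constant that is uniform comes from \<open>normal_cone_bound\<close>.\<close>

definition normal_cone :: "'a::euclidean_space set \<Rightarrow> 'a \<Rightarrow> 'a set" where
  "normal_cone A a = {v. \<exists>K. \<forall>b\<in>A. v \<bullet> (b - a) \<le> K * (norm (b - a))\<^sup>2}"

text \<open>Taken as the polar cone of the normals instead of through limits of secants, so that
  convexity and closedness are immediate. The link to points of \<open>A\<close> is then a matter of
  proof, in \<open>tangent_approximation\<close> and
  \<open>tangent_vectors_realized\<close>.\<close>

definition tangent_cone :: "'a::euclidean_space set \<Rightarrow> 'a \<Rightarrow> 'a set" where
  "tangent_cone A a = {u. \<forall>v\<in>normal_cone A a. u \<bullet> v \<le> 0}"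

lemma infdist_eqI:
  assumes "a \<in> A" "\<And>b. b \<in> A \<Longrightarrow> dist z a \<le> dist z b"
  shows "infdist z A = dist z a"
proof (rule antisym)
  have "A \<noteq> {}" using assms(1) by blast
  then show "dist z a \<le> infdist z A"
    using assms(2) by (auto simp: infdist_notempty intro!: cINF_greatest)
qed (simp add: assms(1) infdist_le)

lemma normal_cone_zero: "0 \<in> normal_cone A a"
  by (auto simp: normal_cone_def intro: exI[of _ 0])

lemma normal_cone_scaleR:
  assumes "v \<in> normal_cone A a" "0 \<le> c"
  shows "c *\<^sub>R v \<in> normal_cone A a"
proof -
  obtain K where "\<forall>b\<in>A. v \<bullet> (b - a) \<le> K * (norm (b - a))\<^sup>2"
    using assms(1) by (auto simp: normal_cone_def)
  then have "\<forall>b\<in>A. (c *\<^sub>R v) \<bullet> (b - a) \<le> (c * K) * (norm (b - a))\<^sup>2"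
    using assms(2) by (auto simp: mult.assoc intro: mult_left_mono)
  then show ?thesis
    unfolding normal_cone_def by blast
qed

lemma normal_cone_add:
  assumes "v \<in> normal_cone A a" "w \<in> normal_cone A a"
  shows "v + w \<in> normal_cone A a"
proof -
  obtain K K' where "\<forall>b\<in>A. v \<bullet> (b - a) \<le> K * (norm (b - a))\<^sup>2"
    "\<forall>b\<in>A. w \<bullet> (b - a) \<le> K' * (norm (b - a))\<^sup>2"
    using assms by (auto simp: normal_cone_def)
  then have "\<forall>b\<in>A. (v + w) \<bullet> (b - a) \<le> (K + K') * (norm (b - a))\<^sup>2"
    by (auto simp: inner_add_left distrib_right intro: add_mono)
  then show ?thesis
    unfolding normal_cone_def by blast
qed

lemma convex_normal_cone: "convex (normal_cone A a)"
  and cone_normal_cone: "cone (normal_cone A a)"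
  using convex_cone[of "normal_cone A a"] normal_cone_add normal_cone_scaleR by blast+

lemma diff_nearest_in_normal_cone:
  assumes "\<And>b. b \<in> A \<Longrightarrow> dist z y \<le> dist z b"
  shows "z - y \<in> normal_cone A y"
proof -
  have "(z - y) \<bullet> (b - y) \<le> 1/2 * (norm (b - y))\<^sup>2" if "b \<in> A" for b
  proof -
    have "(norm (z - y))\<^sup>2 \<le> (norm (z - b))\<^sup>2"
      using assms[OF that] by (simp add: dist_norm)
    then show ?thesis
      by (simp add: power2_norm_eq_inner algebra_simps inner_commute)
  qed
  then show ?thesis
    unfolding normal_cone_def by blast
qed

lemma tangent_cone_zero: "0 \<in> tangent_cone A a"
  by (auto simp: tangent_cone_def)

lemma tangent_cone_scaleR: "u \<in> tangent_cone A a \<Longrightarrow> 0 \<le> c \<Longrightarrow> c *\<^sub>R u \<in> tangent_cone A a"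
  by (auto simp: tangent_cone_def mult_nonneg_nonpos)

lemma tangent_cone_add:
  "u \<in> tangent_cone A a \<Longrightarrow> v \<in> tangent_cone A a \<Longrightarrow> u + v \<in> tangent_cone A a"
  by (force simp: tangent_cone_def inner_add_left)

lemma convex_tangent_cone: "convex (tangent_cone A a)"
  and cone_tangent_cone: "cone (tangent_cone A a)"
  using convex_cone[of "tangent_cone A a"] tangent_cone_add tangent_cone_scaleR by blast+

lemma closed_tangent_cone: "closed (tangent_cone A a)"
proof -
  have "tangent_cone A a = (\<Inter>v\<in>normal_cone A a. {u. u \<bullet> v \<le> 0})"
    by (auto simp: tangent_cone_def)
  then show ?thesis
    by (auto intro!: closed_Collect_le continuous_intros)
qed

text \<open>Moreau's decomposition: the variational inequality of the projection \<open>q\<close>,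
  tested at \<open>q + v\<close> and at \<open>0\<close>, puts the residual \<open>z - q\<close>
  into the polar cone and makes it orthogonal to \<open>q\<close>.\<close>

lemma closest_point_cone:
  fixes N :: "'a::euclidean_space set"
  assumes "convex N" "cone N" "closed N" "N \<noteq> {}"
  shows "\<And>v. v \<in> N \<Longrightarrow> (z - closest_point N z) \<bullet> v \<le> 0"
    and "(z - closest_point N z) \<bullet> closest_point N z = 0"
proof -
  let ?q = "closest_point N z"
  have q: "?q \<in> N" using assms closest_point_in_set by blast
  have add: "v + w \<in> N" if "v \<in> N" "w \<in> N" for v w
    using convex_cone[of N] assms that by blast
  have dot: "(z - ?q) \<bullet> (x - ?q) \<le> 0" if "x \<in> N" for x
    using closest_point_dot assms that by blast
  show "(z - ?q) \<bullet> v \<le> 0" if "v \<in> N" for v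
    using dot[OF add[OF q that]] by simp
  moreover have "(0::'a) \<in> N" using assms cone_contains_0 by blast
  ultimately show "(z - ?q) \<bullet> ?q = 0"
    using dot[of 0] q by (simp add: antisym)
qed

section \<open>Sets with unique nearest points in a tube of radius \<open>R\<close>\<close>

locale unp_tube =
  fixes A :: "'a::euclidean_space set" and R :: real
  assumes nonempty: "A \<noteq> {}" and R_pos: "0 < R"
    and unp: "\<And>z. infdist z A < R \<Longrightarrow> z \<in> Unp A"
begin

text \<open>A limit point has distance \<open>0\<close> from \<open>A\<close>, hence lies in the
  tube, and the nearest point that \<open>Unp\<close> provides can only be itself.\<close>

lemma closed_A: "closed A"
proof -
  have "z \<in> A" if "z \<in> closure A" for z
  proof -
    have "infdist z A = 0"
      using that nonempty in_closure_iff_infdist_zero by blast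
    with unp[of z] R_pos show ?thesis
      by (auto simp: Unp_def)
  qed
  then show ?thesis
    using closure_subset_eq by blast
qed

lemma nearest_exists:
  obtains a where "a \<in> A" "dist z a = infdist z A" "\<And>b. b \<in> A \<Longrightarrow> dist z a \<le> dist z b"
  using distance_attains_inf[OF closed_A nonempty, of z] infdist_eqI[of _ A z] by metis

lemma nearest_unique:
  assumes "infdist z A < R" "a \<in> A" "dist z a = infdist z A" "b \<in> A" "dist z b = infdist z A"
  shows "a = b"
  using unp[OF assms(1)] assms(2-) by (auto simp: Unp_def)

text \<open>By uniqueness the graph of \<open>p\<close> is the closed set where \<open>dist\<close>
  equals \<open>infdist\<close>, and the values of \<open>p\<close> stay in a compact set. A closed
  graph into a compact set means continuity.\<close>

lemma continuous_on_nearest: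
  assumes "\<And>y. y \<in> cball z \<rho> \<Longrightarrow> p y \<in> A \<and> dist y (p y) = infdist y A \<and> infdist y A < R"
  shows "continuous_on (cball z \<rho>) p"
proof -
  let ?S = "cball z \<rho>"
  define T where "T = A \<inter> cball z (\<rho> + R)"
  have T: "compact T"
    unfolding T_def using closed_A by (simp add: closed_Int_compact)
  have pT: "p \<in> ?S \<rightarrow> T"
  proof
    fix y assume y: "y \<in> ?S"
    show "p y \<in> T"
      using assms[OF y] y dist_triangle[of z "p y" y] by (simp add: T_def)
  qed
  have "(\<lambda>y. (y, p y)) ` ?S = (?S \<times> T) \<inter> {q. dist (fst q) (snd q) = infdist (fst q) A}"
  proof (intro set_eqI iffI)
    fix q assume "q \<in> (?S \<times> T) \<inter> {q. dist (fst q) (snd q) = infdist (fst q) A}"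
    then have q: "fst q \<in> ?S" "snd q \<in> A" "dist (fst q) (snd q) = infdist (fst q) A"
      by (auto simp: T_def)
    then have "snd q = p (fst q)"
      using assms[OF q(1)] nearest_unique by blast
    then show "q \<in> (\<lambda>y. (y, p y)) ` ?S"
      using q(1) by (intro image_eqI[of _ _ "fst q"]) (auto simp: prod_eq_iff)
  next
    fix q assume "q \<in> (\<lambda>y. (y, p y)) ` ?S"
    then obtain y where "y \<in> ?S" "q = (y, p y)" by blast
    then show "q \<in> (?S \<times> T) \<inter> {q. dist (fst q) (snd q) = infdist (fst q) A}"
      using assms[of y] pT by (simp add: Pi_iff)
  qed
  moreover have "closed {q::'a \<times> 'a. dist (fst q) (snd q) = infdist (fst q) A}"
    by (intro closed_Collect_eq continuous_intros)
  ultimately have "closedin (top_of_set (?S \<times> T)) ((\<lambda>y. (y, p y)) ` ?S)"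
    by (simp only: closedin_closed_Int)
  then show ?thesis
    by (simp only: continuous_closed_graph_eq[OF T pT])
qed

text \<open>The fixed point \<open>y\<close> of \<open>y \<mapsto> z + \<rho> (z - p y) / |z - p y|\<close>, where \<open>p\<close> is the nearest point map,
  has \<open>z\<close> on the segment from \<open>p y\<close> to \<open>y\<close>; hence \<open>p y = p z\<close>.\<close>

lemma nearest_extend:
  assumes a: "a \<in> A" "dist z a = infdist z A" "z \<noteq> a" and \<rho>: "0 < \<rho>" "dist z a + \<rho> < R"
  shows "infdist (z + (\<rho> / norm (z - a)) *\<^sub>R (z - a)) A = norm (z - a) + \<rho>"
proof -
  define p where "p y = (SOME b. b \<in> A \<and> dist y b = infdist y A)" for y
  have p: "p y \<in> A \<and> dist y (p y) = infdist y A" for y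
    unfolding p_def by (rule someI_ex) (metis nearest_exists)
  have zA: "z \<notin> A"
    using a by auto
  have small: "infdist y A < R" if "y \<in> cball z \<rho>" for y
    using infdist_triangle[of y A z] that \<rho> a by (simp add: dist_commute)
  have cont: "continuous_on (cball z \<rho>) p"
    by (rule continuous_on_nearest) (use p small in auto)
  define f where "f y = z + (\<rho> / norm (z - p y)) *\<^sub>R (z - p y)" for y
  have ne: "z - p y \<noteq> 0" for y
    using p zA by (metis eq_iff_diff_eq_0)
  have "continuous_on (cball z \<rho>) f"
    unfolding f_def using ne by (intro continuous_intros cont) auto
  moreover have "f \<in> cball z \<rho> \<rightarrow> cball z \<rho>"
    using \<rho> ne by (auto simp: f_def dist_norm)
  ultimately obtain y where y: "y \<in> cball z \<rho>" "f y = y"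
    using brouwer[of "cball z \<rho>" f] \<rho> by (auto simp: less_imp_le)
  define c where "c = p y"
  have c: "c \<in> A" "dist y c = infdist y A" "z \<noteq> c"
    using p[of y] ne[of y] by (auto simp: c_def)
  have yz: "y = z + (\<rho> / norm (z - c)) *\<^sub>R (z - c)"
    using y(2) by (simp add: f_def c_def)
  have "y - c = (1 + \<rho> / norm (z - c)) *\<^sub>R (z - c)"
    by (simp add: yz algebra_simps)
  then have "dist y c = (1 + \<rho> / norm (z - c)) * norm (z - c)"
    using \<rho> by (simp add: dist_norm)
  then have d: "dist y c = norm (z - c) + \<rho>"
    using c(3) by (simp add: distrib_right)
  have dyz: "dist y z = \<rho>"
    using \<rho> c(3) by (simp add: yz dist_norm)
  \<comment> \<open>As \<open>z\<close> lies between \<open>c\<close> and \<open>y\<close>, a point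
    of \<open>A\<close> closer to \<open>z\<close> than \<open>c\<close> would also be closer to
    \<open>y\<close> than \<open>c\<close>.\<close>
  have "dist z c \<le> dist z b" if "b \<in> A" for b
  proof -
    have "dist y c \<le> dist y b" using c that by (simp add: infdist_le)
    then show ?thesis
      using d dyz dist_triangle[of y b z] by (simp add: dist_norm)
  qed
  then have "dist z c = infdist z A"
    using infdist_eqI[OF c(1), of z] by simp
  moreover have "infdist z A < R"
    using a(2) \<rho> by linarith
  ultimately have "c = a"
    by (intro nearest_unique[OF _ c(1) _ a(1,2)])
  then show ?thesis
    using d c(2) unfolding yz by simp
qed

text \<open>For small \<open>t\<close>, depending on \<open>K\<close>, the point \<open>a\<close> is
  nearest to \<open>a + t v\<close>. By \<open>nearest_extend\<close> it stays nearest up to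
  distance \<open>R / 2\<close> along the ray, so a ball of radius \<open>R / 2\<close> touching
  \<open>a\<close> contains no point of \<open>A\<close> in its interior; expanding the square turns
  this into the constant \<open>1 / R\<close>.\<close>

lemma normal_cone_bound:
  assumes a: "a \<in> A" and v: "v \<in> normal_cone A a" and b: "b \<in> A"
  shows "v \<bullet> (b - a) \<le> norm v * (norm (b - a))\<^sup>2 / R"
proof (cases "v = 0")
  case False
  obtain K where K: "\<And>b. b \<in> A \<Longrightarrow> v \<bullet> (b - a) \<le> K * (norm (b - a))\<^sup>2"
    using v by (auto simp: normal_cone_def)
  define K1 where "K1 = max K 1"
  have K1: "v \<bullet> (b - a) \<le> K1 * (norm (b - a))\<^sup>2" if "b \<in> A" for b
    using K[OF that] mult_right_mono[of K K1 "(norm (b - a))\<^sup>2"] by (simp add: K1_def)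
  have K1_pos: "K1 > 0" by (simp add: K1_def)
  \<comment> \<open>The first bound makes \<open>a\<close> nearest to \<open>z\<close>, the second
    keeps \<open>z\<close> short of distance \<open>R / 2\<close>, so that there is a positive
    length left to extend.\<close>
  define t where "t = min (1 / (2 * K1)) (R / (4 * norm v))"
  have t: "0 < t" "2 * t * K1 \<le> 1" "t * norm v < R / 2"
  proof -
    show "0 < t" using K1_pos False R_pos by (simp add: t_def)
    have "t \<le> 1 / (2 * K1)" by (simp add: t_def)
    then show "2 * t * K1 \<le> 1" using K1_pos by (simp add: field_simps)
    have "t \<le> R / (4 * norm v)" by (simp add: t_def)
    then have "t * norm v \<le> R / 4" using False by (simp add: field_simps)
    then show "t * norm v < R / 2" using R_pos by simp
  qed
  define z where "z = a + t *\<^sub>R v"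
  have za: "norm (z - a) = t * norm v" "z \<noteq> a"
    using t False by (auto simp: z_def)
  have "dist z a \<le> dist z b" if "b \<in> A" for b
  proof -
    have "2 * t * (v \<bullet> (b - a)) \<le> 2 * t * (K1 * (norm (b - a))\<^sup>2)"
      using K1[OF that] t by simp
    also have "\<dots> \<le> 1 * (norm (b - a))\<^sup>2"
      using mult_right_mono[OF t(2), of "(norm (b - a))\<^sup>2"] by (simp add: mult.assoc)
    finally have *: "2 * t * (v \<bullet> (b - a)) \<le> (norm (b - a))\<^sup>2" by simp
    have "(norm (t *\<^sub>R v - (b - a)))\<^sup>2 =
        (norm (t *\<^sub>R v))\<^sup>2 - 2 * (t *\<^sub>R v \<bullet> (b - a)) + (norm (b - a))\<^sup>2"
      unfolding power2_norm_eq_inner by (simp only: inner_diff inner_commute) simp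
    with * have "(norm (z - a))\<^sup>2 \<le> (norm (z - b))\<^sup>2"
      by (simp add: z_def algebra_simps)
    then show ?thesis
      by (simp add: dist_norm)
  qed
  then have iz: "dist z a = infdist z A"
    using infdist_eqI[OF a] by metis
  \<comment> \<open>Any target distance below \<open>R\<close> could be reached; with
    \<open>R / 2\<close> the factor \<open>2 * s\<close> of the expanded square is exactly
    \<open>R\<close>.\<close>
  define s where "s = R / 2"
  define e where "e = (1 / norm v) *\<^sub>R v"
  have e: "norm e = 1" using False by (simp add: e_def)
  define \<rho> where "\<rho> = s - t * norm v"
  have "infdist (z + (\<rho> / norm (z - a)) *\<^sub>R (z - a)) A = norm (z - a) + \<rho>"
    by (rule nearest_extend) (use a iz za t R_pos in \<open>auto simp: \<rho>_def s_def dist_norm\<close>)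
  moreover have "z + (\<rho> / norm (z - a)) *\<^sub>R (z - a) = a + s *\<^sub>R e"
  proof -
    have "z + (\<rho> / norm (z - a)) *\<^sub>R (z - a) = a + (t + \<rho> / (t * norm v) * t) *\<^sub>R v"
      using za by (simp add: z_def scaleR_add_left)
    moreover have "t + \<rho> / (t * norm v) * t = s / norm v"
      using t False by (simp add: \<rho>_def field_simps)
    ultimately show ?thesis by (simp add: e_def)
  qed
  moreover have "norm (z - a) + \<rho> = s"
    using za by (simp add: \<rho>_def)
  ultimately have "s \<le> dist (a + s *\<^sub>R e) b"
    using infdist_le[OF b, of "a + s *\<^sub>R e"] by simp
  then have "s\<^sup>2 \<le> (norm (s *\<^sub>R e - (b - a)))\<^sup>2"
    using R_pos by (simp add: s_def dist_norm power_mono algebra_simps)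
  also have "\<dots> = s\<^sup>2 * (norm e)\<^sup>2 - 2 * s * (e \<bullet> (b - a)) + (norm (b - a))\<^sup>2"
    unfolding power2_norm_eq_inner
    by (simp add: inner_diff_left inner_diff_right inner_commute power2_eq_square algebra_simps)
  finally have "R * (e \<bullet> (b - a)) \<le> (norm (b - a))\<^sup>2"
    by (simp add: e s_def)
  then have "e \<bullet> (b - a) \<le> (norm (b - a))\<^sup>2 / R"
    using R_pos by (simp add: field_simps)
  then have "norm v * (e \<bullet> (b - a)) \<le> norm v * ((norm (b - a))\<^sup>2 / R)"
    by (intro mult_left_mono) auto
  then show ?thesis
    using False by (simp add: e_def)
qed simp

text \<open>The constants \<open>K\<close> of the individual \<open>v n\<close> might blow up, but
  the bound of \<open>normal_cone_bound\<close> is uniform and passes to the limit.\<close>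

lemma in_normal_cone_limit:
  assumes a: "a \<in> A" and y: "\<And>n. y n \<in> A" "y \<longlonglongrightarrow> a"
    and v: "\<And>n. v n \<in> normal_cone A (y n)" "v \<longlonglongrightarrow> w"
  shows "w \<in> normal_cone A a"
proof -
  have "w \<bullet> (b - a) \<le> (norm w / R) * (norm (b - a))\<^sup>2" if "b \<in> A" for b
  proof -
    have "w \<bullet> (b - a) \<le> norm w * (norm (b - a))\<^sup>2 / R"
    proof (rule LIMSEQ_le)
      show "(\<lambda>n. v n \<bullet> (b - y n)) \<longlonglongrightarrow> w \<bullet> (b - a)"
        by (intro tendsto_intros v y)
      show "(\<lambda>n. norm (v n) * (norm (b - y n))\<^sup>2 / R) \<longlonglongrightarrow> norm w * (norm (b - a))\<^sup>2 / R"
        using R_pos by (intro tendsto_intros v y) auto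
    qed (use normal_cone_bound y v that in blast)
    then show ?thesis by simp
  qed
  then show ?thesis
    unfolding normal_cone_def by blast
qed

lemma closed_normal_cone:
  assumes "a \<in> A"
  shows "closed (normal_cone A a)"
  unfolding closed_sequential_limits
  using in_normal_cone_limit[OF assms, of "\<lambda>_. a"] assms by auto

text \<open>Split \<open>b - a\<close> into its projection \<open>q\<close> to the normal cone and a
  residual \<open>u\<close> in the polar cone. Then
  \<open>q \<bullet> q = q \<bullet> (b - a)\<close>, and the normal bound applied to
  \<open>q\<close> itself shows that \<open>q\<close> is quadratically small.\<close>

lemma tangent_approximation:
  assumes a: "a \<in> A" and b: "b \<in> A"
  obtains u where "u \<in> tangent_cone A a" "norm (b - a - u) \<le> (norm (b - a))\<^sup>2 / R"
proof -
  let ?N = "normal_cone A a"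
  define q where "q = closest_point ?N (b - a)"
  have ne: "?N \<noteq> {}" using normal_cone_zero by blast
  note cp = closest_point_cone[OF convex_normal_cone cone_normal_cone closed_normal_cone[OF a] ne,
      where z = "b - a", folded q_def]
  have q: "q \<in> ?N"
    unfolding q_def using closest_point_in_set closed_normal_cone[OF a] ne by blast
  have "norm q * norm q = q \<bullet> (b - a)"
    using cp(2) by (simp add: inner_diff_left inner_commute[of q] dot_square_norm power2_eq_square)
  also have "\<dots> \<le> norm q * ((norm (b - a))\<^sup>2 / R)"
    using normal_cone_bound[OF a q b] by simp
  finally have "norm q \<le> (norm (b - a))\<^sup>2 / R"
    using R_pos by (cases "q = 0") (auto simp del: times_divide_eq_right)
  moreover have "b - a - q \<in> tangent_cone A a"
    using cp(1) by (auto simp: tangent_cone_def)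
  ultimately show ?thesis
    by (intro that[of "b - a - q"]) auto
qed

text \<open>Otherwise unit normals at points tending to \<open>x\<close> would stay away from the
  normals at \<open>x\<close>; by compactness of the sphere they subconverge, and the limit is a
  normal at \<open>x\<close>.\<close>

lemma normal_cone_upper_semicontinuous:
  assumes x: "x \<in> A" and "0 < \<epsilon>"
  obtains \<delta> where "0 < \<delta>"
    "\<And>y n. y \<in> A \<Longrightarrow> dist x y < \<delta> \<Longrightarrow> n \<in> normal_cone A y \<Longrightarrow> norm n = 1 \<Longrightarrow>
       \<exists>m\<in>normal_cone A x. norm (m - n) < \<epsilon>"
proof (rule ccontr)
  assume neg: "\<not> thesis"
  note witness = that
  have "\<exists>y n. y \<in> A \<and> dist x y < \<delta> \<and> n \<in> normal_cone A y \<and> norm n = 1 \<and>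
      (\<forall>m\<in>normal_cone A x. \<epsilon> \<le> norm (m - n))" if "0 < \<delta>" for \<delta>
  proof (rule ccontr)
    assume "\<not> ?thesis"
    then show False
      using neg witness[OF that] by (metis not_le)
  qed
  then have "\<exists>y n. y \<in> A \<and> dist x y < inverse (real (Suc i)) \<and> n \<in> normal_cone A y \<and> norm n = 1 \<and>
      (\<forall>m\<in>normal_cone A x. \<epsilon> \<le> norm (m - n))" for i
    by simp
  then obtain y n where yn: "\<And>i. y i \<in> A" "\<And>i. dist x (y i) < inverse (real (Suc i))"
      "\<And>i. n i \<in> normal_cone A (y i)" "\<And>i. norm (n i) = 1"
      "\<And>i m. m \<in> normal_cone A x \<Longrightarrow> \<epsilon> \<le> norm (m - n i)"
    by metis
  have "compact (sphere (0::'a) 1)" by simp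
  then obtain w r where r: "strict_mono r" "(n \<circ> r) \<longlonglongrightarrow> w"
    using yn(4) by (metis compact_def mem_sphere_0)
  have "(\<lambda>i. dist (y i) x) \<longlonglongrightarrow> 0"
  proof (rule tendsto_sandwich[OF _ _ tendsto_const LIMSEQ_inverse_real_of_nat])
    show "\<forall>\<^sub>F i in sequentially. dist (y i) x \<le> inverse (real (Suc i))"
      using yn(2) by (auto simp: dist_commute less_imp_le simp del: of_nat_Suc)
  qed auto
  then have "y \<longlonglongrightarrow> x"
    using tendsto_dist_iff by blast
  then have "(y \<circ> r) \<longlonglongrightarrow> x"
    using r(1) LIMSEQ_subseq_LIMSEQ by blast
  then have w: "w \<in> normal_cone A x"
    using in_normal_cone_limit[OF x, of "y \<circ> r" "n \<circ> r" w] yn r by simp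
  have "\<forall>\<^sub>F i in sequentially. dist ((n \<circ> r) i) w < \<epsilon>"
    using r(2) \<open>0 < \<epsilon>\<close> by (rule tendstoD)
  then obtain i where "dist ((n \<circ> r) i) w < \<epsilon>"
    using eventually_happens' sequentially_bot by blast
  then show False
    using yn(5)[OF w, of "r i"] by (simp add: dist_norm norm_minus_commute)
qed

text \<open>Take \<open>y\<close> nearest to \<open>x + u\<close> and let \<open>n\<close> be the
  unit vector from \<open>y\<close> to \<open>x + u\<close>, a normal at \<open>y\<close>. The error
  is \<open>n \<bullet> u + n \<bullet> (x - y)\<close>: the first term is small since
  \<open>n\<close> is close to a normal at \<open>x\<close>, against which \<open>u\<close> is
  nonpositive; the second is quadratic by the normal bound.\<close>

lemma tangent_vectors_realized:
  assumes x: "x \<in> A" and \<epsilon>: "0 < \<epsilon>"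
  obtains \<delta> where "0 < \<delta>"
    "\<And>u. u \<in> tangent_cone A x \<Longrightarrow> norm u < \<delta> \<Longrightarrow> \<exists>y\<in>A. norm (x + u - y) \<le> \<epsilon> * norm u"
proof -
  obtain \<delta> where \<delta>: "0 < \<delta>" and usc:
    "\<And>y n. y \<in> A \<Longrightarrow> dist x y < \<delta> \<Longrightarrow> n \<in> normal_cone A y \<Longrightarrow> norm n = 1 \<Longrightarrow>
       \<exists>m\<in>normal_cone A x. norm (m - n) < \<epsilon> / 2"
    using normal_cone_upper_semicontinuous[OF x, of "\<epsilon> / 2"] \<epsilon> by auto
  show ?thesis
  proof
    \<comment> \<open>Half of \<open>\<delta>\<close> suffices because \<open>y\<close> is within
      \<open>2 * norm u\<close> of \<open>x\<close>; the other bound makes the quadratic term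
      \<open>4 * (norm u)\<^sup>2 / R\<close> at most
      \<open>\<epsilon> / 2 * norm u\<close>.\<close>
    show "0 < min (\<delta> / 2) (\<epsilon> * R / 8)"
      using \<delta> \<epsilon> R_pos by simp
    fix u assume u: "u \<in> tangent_cone A x" "norm u < min (\<delta> / 2) (\<epsilon> * R / 8)"
    obtain y where y: "y \<in> A" "\<And>b. b \<in> A \<Longrightarrow> dist (x + u) y \<le> dist (x + u) b"
      using nearest_exists by metis
    have d1: "norm (x + u - y) \<le> norm u"
      using y(2)[OF x] by (simp add: dist_norm)
    have d2: "norm (x - y) \<le> 2 * norm u"
      using d1 norm_triangle_ineq4[of "x + u - y" u] by (simp add: algebra_simps)
    have "norm (x + u - y) \<le> \<epsilon> * norm u"
    proof (cases "x + u = y")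
      case False
      define n where "n = (1 / norm (x + u - y)) *\<^sub>R (x + u - y)"
      have n: "n \<in> normal_cone A y" "norm n = 1"
        using diff_nearest_in_normal_cone[of A "x + u" y] y False
        by (auto simp: n_def intro!: normal_cone_scaleR)
      have "dist x y < \<delta>"
        using d2 u by (simp add: dist_norm)
      then obtain m where m: "m \<in> normal_cone A x" "norm (m - n) < \<epsilon> / 2"
        using usc y n by blast
      have "norm (x + u - y) = n \<bullet> (x + u - y)"
        using False by (simp add: n_def dot_square_norm power2_eq_square)
      also have "\<dots> = (n - m) \<bullet> u + u \<bullet> m + n \<bullet> (x - y)"
        by (simp add: inner_diff_left inner_diff_right inner_add_right inner_commute)
      also have "\<dots> \<le> \<epsilon> / 2 * norm u + 0 + (norm (x - y))\<^sup>2 / R"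
      proof (intro add_mono)
        have "(n - m) \<bullet> u \<le> norm (n - m) * norm u"
          by (rule norm_cauchy_schwarz)
        also have "\<dots> \<le> \<epsilon> / 2 * norm u"
          using m(2) by (intro mult_right_mono) (auto simp: norm_minus_commute)
        finally show "(n - m) \<bullet> u \<le> \<epsilon> / 2 * norm u" .
        show "u \<bullet> m \<le> 0" using u m by (auto simp: tangent_cone_def)
        show "n \<bullet> (x - y) \<le> (norm (x - y))\<^sup>2 / R"
          using normal_cone_bound[OF y(1) n(1) x] n by simp
      qed
      also have "(norm (x - y))\<^sup>2 / R \<le> (2 * norm u)\<^sup>2 / R"
        using d2 R_pos by (intro divide_right_mono power_mono) auto
      also have "(2 * norm u)\<^sup>2 / R = 4 * norm u / R * norm u"
        by (simp add: power2_eq_square)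
      also have "\<dots> \<le> \<epsilon> / 2 * norm u"
        using u R_pos by (intro mult_right_mono) (auto simp: field_simps)
      finally show ?thesis by simp
    qed (use \<epsilon> in auto)
    then show "\<exists>y\<in>A. norm (x + u - y) \<le> \<epsilon> * norm u"
      using y by blast
  qed
qed

end

section \<open>Linear algebra\<close>

definition orth_proj :: "'a::euclidean_space set \<Rightarrow> ('a \<Rightarrow> 'a) \<Rightarrow> bool" where
  "orth_proj W P \<longleftrightarrow> linear P \<and> (\<forall>x. P x \<in> W) \<and> (\<forall>x. \<forall>w\<in>W. P x \<bullet> w = x \<bullet> w)"

lemma orth_proj_exists:
  fixes W :: "'a::euclidean_space set"
  assumes "subspace W"
  obtains P where "orth_proj W P"
proof -
  obtain B where B: "B \<subseteq> W" "pairwise orthogonal B" "\<And>x. x \<in> B \<Longrightarrow> norm x = 1"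
      "independent B" "span B = W"
    using orthonormal_basis_subspace[OF assms] by metis
  have fin: "finite B" using B(4) independent_imp_finite by blast
  define P where "P x = (\<Sum>b\<in>B. (x \<bullet> b) *\<^sub>R b)" for x
  have "linear P"
    unfolding P_def
    by (intro linear_compose_sum ballI linearI) (simp_all add: inner_add_left scaleR_add_left)
  moreover have "P x \<in> W" for x
    unfolding P_def using B(1) by (intro subspace_sum subspace_scale assms) auto
  moreover have "P x \<bullet> w = x \<bullet> w" if "w \<in> W" for x w
  proof -
    have "P x \<bullet> c = x \<bullet> c" if "c \<in> B" for c
    proof -
      have "P x \<bullet> c = (\<Sum>b\<in>B. (x \<bullet> b) * (b \<bullet> c))"
        by (simp add: P_def inner_sum_left)
      also have "\<dots> = (\<Sum>b\<in>B. if b = c then x \<bullet> c else 0)"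
        using B(2,3) that
        by (intro sum.cong) (auto simp: pairwise_def orthogonal_def dot_square_norm)
      also have "\<dots> = x \<bullet> c"
        using that fin by simp
      finally show ?thesis .
    qed
    then have "orthogonal (P x - x) c" if "c \<in> B" for c
      using that by (simp add: orthogonal_def inner_diff_left)
    then have "orthogonal (P x - x) w"
      using orthogonal_to_span[of w B "P x - x"] B(5) that by blast
    then show ?thesis
      by (simp add: orthogonal_def inner_diff_left)
  qed
  ultimately show ?thesis
    by (intro that[of P]) (simp add: orth_proj_def)
qed

section \<open>Properties of orthogonal projections\<close>

context
  fixes W :: "'a::euclidean_space set" and P
  assumes P: "orth_proj W P" and W: "subspace W"
begin

lemma orth_proj_linear: "linear P" and orth_proj_in: "P x \<in> W"
  and orth_proj_inner: "w \<in> W \<Longrightarrow> P x \<bullet> w = x \<bullet> w"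
  using P by (auto simp: orth_proj_def)

lemma orth_proj_diff: "P (x - y) = P x - P y"
  using orth_proj_linear linear_diff by blast

lemma orth_proj_id: "w \<in> W \<Longrightarrow> P w = w"
proof -
  assume w: "w \<in> W"
  have "(P w - w) \<bullet> (P w - w) = 0"
    using orth_proj_inner[of "P w - w" w] w W by (simp add: inner_diff_left orth_proj_in subspace_diff)
  then show ?thesis by simp
qed

lemma orth_proj_norm_le: "norm (P x) \<le> norm x"
proof -
  have "norm (P x) * norm (P x) = x \<bullet> P x"
    using orth_proj_inner[OF orth_proj_in, of x x] by (simp add: dot_square_norm power2_eq_square)
  also have "\<dots> \<le> norm x * norm (P x)"
    by (rule norm_cauchy_schwarz)
  finally show ?thesis
    by (cases "P x = 0") auto
qed

lemma orth_proj_nearest: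
  assumes "w \<in> W"
  shows "norm (x - P x) \<le> norm (x - w)"
proof -
  have "(x - P x) \<bullet> (P x - w) = 0"
    using orth_proj_inner[of "P x - w" x] assms W
    by (simp add: inner_diff_left orth_proj_in subspace_diff)
  then have "(norm ((x - P x) + (P x - w)))\<^sup>2 = (norm (x - P x))\<^sup>2 + (norm (P x - w))\<^sup>2"
    by (intro norm_add_Pythagorean) (simp add: orthogonal_def)
  then have "(norm (x - P x))\<^sup>2 \<le> (norm (x - w))\<^sup>2"
    by simp
  then show ?thesis by simp
qed

lemma orth_proj_eq_0D:
  assumes "P x = 0"
  shows "x \<in> W\<^sup>\<bottom>"
  using orth_proj_inner[of _ x] assms by (auto simp: orthogonal_comp_def orthogonal_def inner_commute)

end

text \<open>A closed convex cone that is nearly as large as a subspace of at least its dimension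
  is itself a subspace: a supporting normal \<open>n\<close> of the cone in its span would be the projection
  of some \<open>e\<close> in the given subspace, and the cone has a vector near \<open>e\<close>.\<close>

lemma cone_near_subspace:
  fixes T L :: "'a::euclidean_space set"
  assumes T: "convex T" "cone T" "closed T" "0 \<in> T" and L: "subspace L" and dim: "dim T \<le> dim L"
    and near: "\<And>e. e \<in> L \<Longrightarrow> norm e = 1 \<Longrightarrow> \<exists>u\<in>T. norm (u - e) \<le> 1/3"
  shows "subspace T" "dim T = dim L" "\<And>u. u \<in> T \<Longrightarrow> \<exists>e\<in>L. norm (u - e) \<le> norm u / 2"
proof -
  define M where "M = span T"
  have M: "subspace M" "dim M \<le> dim L" "T \<subseteq> M"
    using dim by (auto simp: M_def span_superset)
  obtain P where P: "orth_proj M P" using orth_proj_exists M by blast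
  note Pf = orth_proj_linear[OF P M(1)] orth_proj_in[OF P M(1)] orth_proj_inner[OF P M(1)]
  have near': "\<exists>u\<in>T. norm (u - e) \<le> norm e / 3" if "e \<in> L" for e
  proof (cases "e = 0")
    case False
    have "(1 / norm e) *\<^sub>R e \<in> L"
      using that L subspace_scale by blast
    moreover have "norm ((1 / norm e) *\<^sub>R e) = 1"
      using False by simp
    ultimately obtain u where u: "u \<in> T" "norm (u - (1 / norm e) *\<^sub>R e) \<le> 1/3"
      using near by blast
    have "norm e * norm (u - (1 / norm e) *\<^sub>R e) \<le> norm e * (1/3)"
      using u(2) by (intro mult_left_mono) auto
    moreover have "norm e * norm (u - (1 / norm e) *\<^sub>R e) = norm (norm e *\<^sub>R (u - (1 / norm e) *\<^sub>R e))"
      by simp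
    moreover have "norm e *\<^sub>R (u - (1 / norm e) *\<^sub>R e) = norm e *\<^sub>R u - e"
      using False by (simp add: scaleR_diff_right)
    moreover have "norm e *\<^sub>R u \<in> T"
      using u(1) T(2) by (simp add: cone_def)
    ultimately show ?thesis
      by (intro bexI[of _ "norm e *\<^sub>R u"]) auto
  qed (use T(4) in auto)
  \<comment> \<open>This positivity is used twice: it makes \<open>P\<close> injective on
    \<open>L\<close>, and it contradicts a supporting normal of the form \<open>P e\<close>.\<close>
  have pos: "\<exists>u\<in>T. 0 < u \<bullet> P e" if e: "e \<in> L" "e \<noteq> 0" for e
  proof -
    obtain u where u: "u \<in> T" "norm (u - e) \<le> norm e / 3"
      using near' e by blast
    have "\<bar>(u - e) \<bullet> e\<bar> \<le> norm (u - e) * norm e"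
      by (rule Cauchy_Schwarz_ineq2)
    also have "\<dots> \<le> norm e / 3 * norm e"
      using u(2) by (intro mult_right_mono) auto
    also have "\<dots> < norm e * norm e"
      using e(2) by simp
    finally have "\<bar>u \<bullet> e - e \<bullet> e\<bar> < e \<bullet> e"
      by (simp add: inner_diff_left dot_square_norm power2_eq_square)
    then have "0 < u \<bullet> e" by linarith
    then have "0 < u \<bullet> P e"
      using Pf(3)[of u e] u M by (auto simp: inner_commute)
    with u show ?thesis by blast
  qed
  have "inj_on P L"
  proof (rule inj_onI)
    fix x y assume "x \<in> L" "y \<in> L" "P x = P y"
    then have "x - y \<in> L" "P (x - y) = 0"
      using L Pf(1) by (auto simp: subspace_diff linear_diff)
    then show "x = y"
      using pos[of "x - y"] by auto
  qed
  then have dimPL: "dim (P ` L) = dim L"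
    using dim_image_eq[OF Pf(1), of L] L by (simp add: span_eq_iff[THEN iffD2])
  \<comment> \<open>The image lies in \<open>M\<close> and has dimension \<open>dim L\<close>, which
    is at least \<open>dim M\<close>.\<close>
  have PL: "P ` L = M"
    using Pf(1,2) L M dimPL by (intro subspace_dim_equal linear_subspace_image) auto
  have TM: "T = M"
  proof (rule ccontr)
    assume "T \<noteq> M"
    then obtain z where z: "z \<in> M" "z \<notin> T" using M by blast
    define q where "q = closest_point T z"
    have Tne: "T \<noteq> {}" using T by blast
    have q: "q \<in> T"
      unfolding q_def using T(3) Tne closest_point_in_set by blast
    then have "z - q \<in> M" "z - q \<noteq> 0"
      using z M by (auto simp: subspace_diff)
    then obtain e where e: "e \<in> L" "P e = z - q"
      using PL by (metis imageE)
    with \<open>z - q \<noteq> 0\<close> Pf(1) have "e \<noteq> 0"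
      using linear_0 by metis
    then obtain u where "u \<in> T" "0 < u \<bullet> (z - q)"
      using pos e by metis
    then show False
      using closest_point_cone(1)[OF T(1,2,3) Tne, of u z] by (simp add: q_def inner_commute)
  qed
  then show "subspace T" "dim T = dim L"
    using M dimPL PL by auto
  show "\<exists>e\<in>L. norm (u - e) \<le> norm u / 2" if u: "u \<in> T" for u
  proof -
    \<comment> \<open>As \<open>u\<close> is the point of \<open>T\<close> closest to
      \<open>e\<close>, its distance from \<open>e\<close> is at most a third of
      \<open>norm e\<close>; measured against \<open>norm u\<close> the third becomes a
      half.\<close>
    obtain e where e: "e \<in> L" "u = P e"
      using u TM PL by blast
    obtain u' where "u' \<in> T" "norm (u' - e) \<le> norm e / 3"
      using near' e by blast
    then have "norm (e - u) \<le> norm e / 3"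
      using orth_proj_nearest[OF P M(1), of u' e] TM e by (simp add: norm_minus_commute)
    moreover have "norm e \<le> norm u + norm (e - u)"
      using norm_triangle_ineq[of u "e - u"] by simp
    ultimately have "norm (u - e) \<le> norm u / 2"
      by (simp add: norm_minus_commute)
    with e show ?thesis by blast
  qed
qed

text \<open>On \<open>L\<close>, the map \<open>h\<close> is the inverse of \<open>Q\<close>
  restricted to \<open>T\<close>, with norm at most \<open>2\<close>. A total linear map is used
  because it later supplies the derivative of the graph function.\<close>

definition projects_onto :: "('a::euclidean_space \<Rightarrow> 'a) \<Rightarrow> 'a set \<Rightarrow> 'a set \<Rightarrow> ('a \<Rightarrow> 'a) \<Rightarrow> bool" where
  "projects_onto Q L T h \<longleftrightarrow> linear h \<and> (\<forall>w\<in>L. h w \<in> T \<and> Q (h w) = w \<and> norm (h w) \<le> 2 * norm w) \<and>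
     (\<forall>u\<in>T. h (Q u) = u)"

text \<open>Vectors \<open>u\<close> of \<open>T\<close> are within half their norm of
  \<open>L\<close>, so \<open>norm u \<le> 2 * norm (Q u)\<close>. Thus \<open>Q\<close> is
  injective on \<open>T\<close>, and equality of dimensions makes it onto \<open>L\<close>.\<close>

lemma cone_near_subspace_projects_onto:
  fixes T L :: "'a::euclidean_space set"
  assumes T: "convex T" "cone T" "closed T" "0 \<in> T" and L: "subspace L" and dim: "dim T \<le> dim L"
    and near: "\<And>e. e \<in> L \<Longrightarrow> norm e = 1 \<Longrightarrow> \<exists>u\<in>T. norm (u - e) \<le> 1/3"
    and Q: "orth_proj L Q"
  obtains h where "projects_onto Q L T h"
proof -
  note cone = cone_near_subspace[OF T L dim near]
  note Qf = orth_proj_linear[OF Q L] orth_proj_in[OF Q L]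
  have half: "norm u \<le> 2 * norm (Q u)" if u: "u \<in> T" for u
  proof -
    obtain e where e: "e \<in> L" "norm (u - e) \<le> norm u / 2"
      using cone(3)[OF _ _ u] by blast
    then have "norm (u - Q u) \<le> norm u / 2"
      using orth_proj_nearest[OF Q L e(1), of u] by simp
    then show ?thesis
      using norm_triangle_ineq[of "Q u" "u - Q u"] by simp
  qed
  have subT: "subspace T" "dim T = dim L"
    using cone by blast+
  have spT: "span T = T" using subT span_eq_iff by blast
  have inj: "inj_on Q T"
  proof (rule inj_onI)
    fix x y assume xy: "x \<in> T" "y \<in> T" "Q x = Q y"
    then have "x - y \<in> T" "Q (x - y) = 0"
      using subT Qf(1) by (auto simp: subspace_diff linear_diff)
    then show "x = y" using half[of "x - y"] by simp
  qed
  then obtain h where h: "range h \<subseteq> T" "linear h" "\<forall>x\<in>T. h (Q x) = x"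
    using linear_inj_on_left_inverse[OF Qf(1), of T] spT by auto
  have "dim (Q ` T) = dim T"
    using dim_image_eq[OF Qf(1), of T] inj spT by simp
  then have QT: "Q ` T = L"
    using Qf L subT by (intro subspace_dim_equal linear_subspace_image) auto
  have "projects_onto Q L T h"
    unfolding projects_onto_def
  proof (intro conjI ballI)
    fix w assume "w \<in> L"
    then obtain u where u: "u \<in> T" "w = Q u" using QT by blast
    then show "h w \<in> T" "Q (h w) = w" "norm (h w) \<le> 2 * norm w"
      using h half[of u] by auto
  qed (use h in auto)
  then show ?thesis using that by blast
qed

section \<open>Charts\<close>

text \<open>A converse of Taylor's theorem. Differentiability is immediate; the Lipschitz bound
  compares the expansions from \<open>u\<close> to \<open>v\<close>, from \<open>v\<close> to
  \<open>v + h\<close> and from \<open>u\<close> to \<open>v + h\<close>. The radius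
  \<open>3 * r\<close> leaves room for \<open>v + h\<close>.\<close>

lemma C11_onI_quadratic:
  fixes f :: "'a::euclidean_space \<Rightarrow> 'a"
  assumes W: "subspace W" and K: "0 \<le> K"
    and lin: "\<And>u. u \<in> W \<inter> ball c (3 * r) \<Longrightarrow> linear (f' u)"
    and quad: "\<And>u v. u \<in> W \<inter> ball c (3 * r) \<Longrightarrow> v \<in> W \<inter> ball c (3 * r) \<Longrightarrow>
      norm (f v - f u - f' u (v - u)) \<le> K * (norm (v - u))\<^sup>2"
  shows "C11_on W (W \<inter> ball c r) f"
  unfolding C11_on_def
proof (intro exI conjI ballI)
  have in3: "u \<in> W \<inter> ball c (3 * r)" if "u \<in> W \<inter> ball c r" for u
    using that zero_le_dist[of c u] by (simp del: zero_le_dist)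
  show "(f has_derivative f' u) (at u within W \<inter> ball c r)" if u: "u \<in> W \<inter> ball c r" for u
    unfolding has_derivative_within_alt
  proof (intro conjI allI impI)
    show "bounded_linear (f' u)"
      using lin[OF in3[OF u]] linear_conv_bounded_linear by blast
    fix e :: real assume e: "0 < e"
    show "\<exists>d>0. \<forall>y\<in>W \<inter> ball c r. norm (y - u) < d \<longrightarrow>
        norm (f y - f u - f' u (y - u)) \<le> e * norm (y - u)"
    proof (intro exI conjI ballI impI)
      \<comment> \<open>\<open>K + 1\<close> instead of \<open>K\<close> avoids a division by
        zero.\<close>
      show "0 < e / (K + 1)" using e K by simp
      fix y assume y: "y \<in> W \<inter> ball c r" "norm (y - u) < e / (K + 1)"
      have "K * norm (y - u) \<le> (K + 1) * norm (y - u)"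
        by (simp add: distrib_right)
      also have "\<dots> \<le> e"
        using y(2) K by (simp add: field_simps)
      finally have "K * norm (y - u) * norm (y - u) \<le> e * norm (y - u)"
        by (intro mult_right_mono) auto
      then show "norm (f y - f u - f' u (y - u)) \<le> e * norm (y - u)"
        using quad[OF in3[OF u] in3[OF y(1)]] by (simp add: power2_eq_square mult.assoc)
    qed
  qed
  show "0 \<le> 6 * K" using K by simp
  show "norm (f' u w - f' v w) \<le> 6 * K * dist u v * norm w"
    if u: "u \<in> W \<inter> ball c r" and v: "v \<in> W \<inter> ball c r" and w: "w \<in> W" for u v w
  proof (cases "w = 0 \<or> u = v")
    case True
    then show ?thesis
      using lin[OF in3[OF u]] lin[OF in3[OF v]] by (auto simp: linear_0)
  next
    case False
    define d where "d = dist u v"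
    \<comment> \<open>Rescaling \<open>w\<close> to the length of \<open>v - u\<close> makes all
      three remainders multiples of \<open>K * d\<^sup>2\<close>, with factors \<open>1\<close>,
      \<open>4\<close> and \<open>1\<close>; hence the constant \<open>6 * K\<close>.\<close>
    define h where "h = (d / norm w) *\<^sub>R w"
    have d: "0 < d" "norm (v - u) = d" "norm h = d"
      using False by (auto simp: d_def h_def dist_norm norm_minus_commute)
    have "d < 2 * r"
      using u v dist_triangle3[of u v c] by (simp add: d_def dist_commute)
    then have vh: "v + h \<in> W \<inter> ball c (3 * r)"
      using v w W norm_triangle_ineq4[of "c - v" h] d
      by (auto simp: h_def dist_norm subspace_add subspace_scale diff_diff_eq)
    have tri: "norm (x - y + z) \<le> norm x + norm y + norm z" for x y z :: 'a
      by norm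
    have lu: "linear (f' u)" and lv: "linear (f' v)"
      using lin in3 u v by blast+
    have 1: "norm (f (v + h) - f v - f' v h) \<le> K * d\<^sup>2"
      using quad[OF in3[OF v] vh] d by simp
    have 2: "norm (f (v + h) - f u - f' u (v + h - u)) \<le> K * (2 * d)\<^sup>2"
    proof -
      have "norm (v + h - u) \<le> 2 * d"
        using norm_triangle_ineq[of "v - u" h] d by (simp add: algebra_simps)
      then have "K * (norm (v + h - u))\<^sup>2 \<le> K * (2 * d)\<^sup>2"
        using K by (intro mult_left_mono power_mono) auto
      then show ?thesis
        using quad[OF in3[OF u] vh] by simp
    qed
    have 3: "norm (f v - f u - f' u (v - u)) \<le> K * d\<^sup>2"
      using quad[OF in3[OF u] in3[OF v]] d by simp
    have split: "f' u (v + h - u) = f' u (v - u) + f' u h"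
      using linear_add[OF lu, of "v - u" h] by (simp add: algebra_simps)
    have "f' u h - f' v h = (f (v + h) - f v - f' v h) - (f (v + h) - f u - f' u (v + h - u))
        + (f v - f u - f' u (v - u))"
      unfolding split by simp
    then have "norm (f' u h - f' v h) \<le> norm (f (v + h) - f v - f' v h)
        + norm (f (v + h) - f u - f' u (v + h - u)) + norm (f v - f u - f' u (v - u))"
      by (simp only: tri)
    also have "\<dots> \<le> K * d\<^sup>2 + K * (2 * d)\<^sup>2 + K * d\<^sup>2"
      using 1 2 3 by (intro add_mono)
    finally have "norm (f' u h - f' v h) \<le> 6 * K * d * d"
      by (simp add: power2_eq_square)
    moreover have "f' u h - f' v h = (d / norm w) *\<^sub>R (f' u w - f' v w)"
      using lu lv by (simp add: h_def linear_scale scaleR_diff_right)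
    ultimately have "d / norm w * norm (f' u w - f' v w) \<le> 6 * K * d * d"
      using d(1) by (simp del: times_divide_eq_left)
    then have "d * norm (f' u w - f' v w) \<le> d * (6 * K * d * norm w)"
      using False by (simp add: field_simps)
    then show ?thesis
      using d(1) by (simp add: d_def)
  qed
qed

section \<open>Localisation of charts and openness of the smooth points\<close>

lemma C11_on_subset:
  assumes "C11_on W U f" "V \<subseteq> U"
  shows "C11_on W V f"
proof -
  obtain f' L where f: "\<And>u. u \<in> U \<Longrightarrow> (f has_derivative f' u) (at u within U)" "0 \<le> L"
     "\<And>u v w. u \<in> U \<Longrightarrow> v \<in> U \<Longrightarrow> w \<in> W \<Longrightarrow> norm (f' u w - f' v w) \<le> L * dist u v * norm w"
    using assms(1) unfolding C11_on_def by blast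
  then have "(f has_derivative f' u) (at u within V)" if "u \<in> V" for u
    using assms(2) that has_derivative_subset by blast
  with f assms(2) show ?thesis
    unfolding C11_on_def by (metis subsetD)
qed

lemma C11_on_imp_continuous_on: "C11_on W U f \<Longrightarrow> continuous_on U f"
  unfolding C11_on_def continuous_on_eq_continuous_within
  using has_derivative_continuous by blast

text \<open>The projection to \<open>W\<close> is continuous and inverts the graph map, so the
  restricted graph is cut out by the open preimage of \<open>O'\<close>.\<close>

lemma graph_restrict_openin:
  fixes W :: "'a::euclidean_space set"
  assumes W: "subspace W" and perp: "\<And>w. w \<in> U \<Longrightarrow> \<phi> w \<in> W\<^sup>\<bottom>" and U: "U \<subseteq> W" and "open O'"
  shows "openin (top_of_set ((\<lambda>w. w + \<phi> w) ` U)) ((\<lambda>w. w + \<phi> w) ` (U \<inter> O'))"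
proof -
  obtain P where P: "orth_proj W P" using orth_proj_exists W by blast
  have Pg: "P (w + \<phi> w) = w" if "w \<in> U" for w
  proof -
    have "P (\<phi> w) \<bullet> P (\<phi> w) = 0"
      using orth_proj_inner[OF P W orth_proj_in[OF P W]] perp[OF that] orth_proj_in[OF P W]
      by (auto simp: orthogonal_comp_def orthogonal_def inner_commute[of "\<phi> w"])
    moreover have "P (w + \<phi> w) = P w + P (\<phi> w)"
      using orth_proj_linear[OF P W] linear_add by blast
    ultimately show ?thesis
      using orth_proj_id[OF P W] U that by auto
  qed
  have "bounded_linear P"
    using orth_proj_linear[OF P W] linear_conv_bounded_linear by blast
  then have "open (P -` O')"
    using \<open>open O'\<close> by (intro open_vimage linear_continuous_on)
  moreover have "(\<lambda>w. w + \<phi> w) ` (U \<inter> O') = (\<lambda>w. w + \<phi> w) ` U \<inter> P -` O'"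
    using Pg by auto
  ultimately show ?thesis
    by (simp add: openin_open_Int)
qed

definition C11_chart :: "nat \<Rightarrow> 'a::euclidean_space set \<Rightarrow> 'a \<Rightarrow> bool" where
  "C11_chart k M a \<longleftrightarrow> (\<exists>W c r \<phi>.
     subspace W \<and> dim W = k \<and> c \<in> W \<and> 0 < r \<and>
     (\<forall>w \<in> W \<inter> ball c r. \<phi> w \<in> W\<^sup>\<bottom>) \<and>
     C11_on W (W \<inter> ball c r) \<phi> \<and>
     openin (top_of_set M) ((\<lambda>w. w + \<phi> w) ` (W \<inter> ball c r)) \<and>
     a \<in> (\<lambda>w. w + \<phi> w) ` (W \<inter> ball c r))"

lemma C11_manifold_iff_chart:
  fixes M :: "'a::euclidean_space set"
  assumes "k \<noteq> 0" "k \<noteq> DIM('a)"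
  shows "C11_manifold k M \<longleftrightarrow> M \<noteq> {} \<and> (\<forall>a\<in>M. C11_chart k M a)"
  using assms unfolding C11_manifold_def C11_chart_def by (simp only: if_False)

text \<open>In intermediate dimensions a chart is shrunk: by continuity of the graph map, a small
  ball about the parameter \<open>w0\<close> of \<open>a\<close> is mapped into
  \<open>N\<close>.\<close>

lemma C11_manifold_openin:
  fixes M N :: "'a::euclidean_space set"
  assumes M: "C11_manifold k M" and N: "openin (top_of_set M) N" "N \<noteq> {}"
  shows "C11_manifold k N"
proof -
  have NM: "N \<subseteq> M" using N openin_imp_subset by blast
  consider "k = 0" | "k \<noteq> 0" "k = DIM('a)" | "k \<noteq> 0" "k \<noteq> DIM('a)" by blast
  then show ?thesis
  proof cases
    case 1
    then have "discrete M" using M by (simp add: C11_manifold_def)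
    then have "discrete N" using NM discrete_subset by blast
    then show ?thesis using 1 by (simp add: C11_manifold_def)
  next
    case 2
    then have "open M" using M by (simp add: C11_manifold_def)
    then have "open N" using N openin_open_trans by blast
    then show ?thesis using 2 N by (simp add: C11_manifold_def)
  next
    case 3
    have "C11_chart k N a" if a: "a \<in> N" for a
    proof -
      have chart: "C11_chart k M a"
        using M a NM by (auto simp: C11_manifold_iff_chart[OF 3])
      obtain W c r \<phi> where c: "subspace W" "dim W = k" "c \<in> W" "0 < r"
           "\<And>w. w \<in> W \<inter> ball c r \<Longrightarrow> \<phi> w \<in> W\<^sup>\<bottom>"
           "C11_on W (W \<inter> ball c r) \<phi>"
           "openin (top_of_set M) ((\<lambda>w. w + \<phi> w) ` (W \<inter> ball c r))"
           "a \<in> (\<lambda>w. w + \<phi> w) ` (W \<inter> ball c r)"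
        using chart unfolding C11_chart_def by blast
      let ?g = "\<lambda>w. w + \<phi> w"
      obtain w0 where w0: "w0 \<in> W \<inter> ball c r" "a = ?g w0" using c(8) by blast
      obtain O' where O': "open O'" "N = M \<inter> O'" using N openin_open by metis
      have cont: "continuous_on (W \<inter> ball c r) ?g"
        by (intro continuous_intros C11_on_imp_continuous_on[OF c(6)])
      have "?g w0 \<in> O'" using w0 a O' by blast
      then obtain V where V: "open V" "w0 \<in> V" "\<And>y. y \<in> W \<inter> ball c r \<Longrightarrow> y \<in> V \<Longrightarrow> ?g y \<in> O'"
        using continuous_on_topological[THEN iffD1, OF cont, rule_format, OF w0(1) O'(1)] by blast
      have "open (V \<inter> ball c r)" "w0 \<in> V \<inter> ball c r"
        using V(1,2) w0(1) by auto
      then obtain s where s: "0 < s" "ball w0 s \<subseteq> V \<inter> ball c r"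
        using open_contains_ball by metis
      then have sub: "W \<inter> ball w0 s \<subseteq> W \<inter> ball c r" by blast
      have eq: "(W \<inter> ball c r) \<inter> ball w0 s = W \<inter> ball w0 s" using sub by blast
      have "openin (top_of_set (?g ` (W \<inter> ball c r))) (?g ` (W \<inter> ball w0 s))"
        using graph_restrict_openin[OF c(1), of "W \<inter> ball c r" \<phi> "ball w0 s"] c(5) eq by simp
      then have "openin (top_of_set M) (?g ` (W \<inter> ball w0 s))"
        using c(7) openin_trans by blast
      moreover have "?g ` (W \<inter> ball w0 s) \<subseteq> N"
      proof
        fix x assume "x \<in> ?g ` (W \<inter> ball w0 s)"
        then obtain y where y: "y \<in> W \<inter> ball w0 s" "x = ?g y" by blast
        then have "x \<in> M" using c(7) sub openin_imp_subset by blast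
        moreover have "x \<in> O'" using V(3)[of y] y s(2) sub by blast
        ultimately show "x \<in> N" using O' by blast
      qed
      ultimately have "openin (top_of_set N) (?g ` (W \<inter> ball w0 s))"
        using NM openin_subset_trans by blast
      moreover have "C11_on W (W \<inter> ball w0 s) \<phi>"
        using C11_on_subset c(6) sub by blast
      moreover have "a \<in> ?g ` (W \<inter> ball w0 s)" using w0 s by auto
      moreover have "\<forall>w\<in>W \<inter> ball w0 s. \<phi> w \<in> W\<^sup>\<bottom>" using c(5) sub by blast
      ultimately show ?thesis
        using c(1,2) w0(1) s(1) unfolding C11_chart_def by blast
    qed
    then show ?thesis
      using N(2) by (simp add: C11_manifold_iff_chart[OF 3])
  qed
qed

text \<open>Passes from a chart domain of any shape to the balls in the definition of smooth points:
  a small ball cuts out of \<open>A\<close> a relatively open piece of \<open>M\<close>.\<close>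

lemma smooth_pointsI_openin:
  assumes "C11_manifold k M" "openin (top_of_set A) M" "a \<in> M"
  shows "a \<in> smooth_points k A"
proof -
  obtain r where r: "0 < r" "ball a r \<inter> A \<subseteq> M"
    using assms(2,3) openin_contains_ball by metis
  have MA: "M \<subseteq> A" using assms(2) openin_imp_subset by blast
  then have "A \<inter> ball a r = M \<inter> ball a r" using r by blast
  moreover have "C11_manifold k (M \<inter> ball a r)"
    by (rule C11_manifold_openin[OF assms(1)]) (use assms(3) r in \<open>auto simp: openin_open_Int\<close>)
  ultimately show ?thesis
    unfolding smooth_points_def using r MA assms(3) by auto
qed

lemma openin_smooth_points: "openin (top_of_set A) (smooth_points k A)"
proof (subst openin_subopen, intro ballI)
  fix a assume "a \<in> smooth_points k A"
  then obtain r where r: "a \<in> A" "0 < r" "C11_manifold k (A \<inter> ball a r)"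
    by (auto simp: smooth_points_def)
  have "openin (top_of_set A) (A \<inter> ball a r)"
    by (simp add: openin_open_Int)
  with r smooth_pointsI_openin
  show "\<exists>T. openin (top_of_set A) T \<and> a \<in> T \<and> T \<subseteq> smooth_points k A"
    by (intro exI[of _ "A \<inter> ball a r"]) auto
qed

section \<open>Flat regions are graphs\<close>

context unp_tube
begin

text \<open>A point with tangent cone of maximal dimension is moved a little in a direction \<open>v\<close> from the
  relative interior of that cone; the points of \<open>A\<close> reached from the old point in the directions
  \<open>v + \<rho> e\<close> then show that the new tangent cones nearly contain every \<open>e\<close>.\<close>

lemma flat_region_exists:
  assumes U: "open U" "A \<inter> U \<noteq> {}"
  obtains L Q x \<tau> where "subspace L" "orth_proj L Q" "x \<in> A" "x \<in> U" "0 < \<tau>"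
    "\<And>y. y \<in> A \<Longrightarrow> dist x y < \<tau> \<Longrightarrow> \<exists>h. projects_onto Q L (tangent_cone A y) h"
proof -
  let ?T = "tangent_cone A"
  obtain x0 where "x0 \<in> A \<inter> U" using U by blast
  \<comment> \<open>Dimensions are bounded, so a maximum over \<open>A \<inter> U\<close> is
    attained.\<close>
  moreover have "\<forall>y. y \<in> A \<inter> U \<longrightarrow> dim (?T y) < Suc DIM('a)"
    using dim_subset_UNIV less_Suc_eq_le by blast
  ultimately obtain x where x: "x \<in> A \<inter> U" and max: "\<And>y. y \<in> A \<inter> U \<Longrightarrow> dim (?T y) \<le> dim (?T x)"
    using ex_has_greatest_nat[of "\<lambda>y. y \<in> A \<inter> U" x0 "\<lambda>y. dim (?T y)"] by metis
  define L where "L = span (?T x)"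
  have L: "subspace L" by (simp add: L_def)
  obtain Q where Q: "orth_proj L Q" using orth_proj_exists L by blast
  have "?T x \<noteq> {}" using tangent_cone_zero by blast
  then obtain v where "v \<in> rel_interior (?T x)"
    using rel_interior_eq_empty[OF convex_tangent_cone] by blast
  moreover have "affine hull (?T x) = L"
    unfolding L_def using tangent_cone_zero by (intro affine_hull_span_0 hull_inc)
  ultimately obtain \<rho> where v: "v \<in> ?T x" "0 < \<rho>" "cball v \<rho> \<inter> L \<subseteq> ?T x"
    unfolding mem_rel_interior_cball by metis
  have vL: "v \<in> L" using v(1) by (simp add: L_def span_base)
  define B where "B = norm v + \<rho>"
  have B: "0 < B" "norm v \<le> B" "\<rho> \<le> B" using v(2) by (auto simp: B_def add_nonneg_pos)
  \<comment> \<open>All directions used below have norm at most \<open>B\<close>; this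
    \<open>\<epsilon>\<close> keeps each realization error at \<open>\<rho> / 12\<close> relative to
    the scale \<open>t\<close>.\<close>
  define \<epsilon> where "\<epsilon> = \<rho> / (12 * B)"
  have \<epsilon>: "0 < \<epsilon>" "\<epsilon> * B = \<rho> / 12" using B v(2) by (auto simp: \<epsilon>_def)
  obtain \<delta> where \<delta>: "0 < \<delta>"
      "\<And>u. u \<in> ?T x \<Longrightarrow> norm u < \<delta> \<Longrightarrow> \<exists>y\<in>A. norm (x + u - y) \<le> \<epsilon> * norm u"
    using tangent_vectors_realized[of x \<epsilon>] x \<epsilon> by blast
  obtain \<eta> where \<eta>: "0 < \<eta>" "ball x \<eta> \<subseteq> U"
    using U(1) x open_contains_ball by blast
  \<comment> \<open>Displacements of length \<open>t * B\<close> then stay within reach of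
    \<open>\<delta>\<close>, inside \<open>U\<close>, and at most \<open>R / 20\<close>, which tames
    the quadratic error at the new points.\<close>
  define t where "t = min (min \<delta> \<eta>) (R / 20) / (2 * B)"
  have m: "0 < min (min \<delta> \<eta>) (R / 20)" using \<delta> \<eta> R_pos by simp
  have t0: "0 < t" using m B unfolding t_def by (intro divide_pos_pos) auto
  have "2 * (t * B) = min (min \<delta> \<eta>) (R / 20)" using B by (simp add: t_def)
  then have tB: "t * B < \<delta>" "t * B < \<eta>" "t * B \<le> R / 20"
    using m by linarith+
  have t\<rho>: "0 < t * \<rho>" "t * \<rho> \<le> R / 20"
    using t0 v(2) tB(3) mult_left_mono[OF B(3) less_imp_le[OF t0]] by (simp, linarith)
  have reach: "\<exists>y\<in>A. norm (x + t *\<^sub>R w - y) \<le> t * \<rho> / 12" if w: "w \<in> ?T x" "norm w \<le> B" for w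
  proof -
    have n: "norm (t *\<^sub>R w) \<le> t * B" using w t0 by simp
    then have "norm (t *\<^sub>R w) < \<delta>" using tB by linarith
    moreover have "t *\<^sub>R w \<in> ?T x" using w t0 by (intro tangent_cone_scaleR) auto
    ultimately obtain y where y: "y \<in> A" "norm (x + t *\<^sub>R w - y) \<le> \<epsilon> * norm (t *\<^sub>R w)"
      using \<delta>(2) by blast
    have "\<epsilon> * norm (t *\<^sub>R w) \<le> \<epsilon> * (t * B)"
      using n \<epsilon> by (intro mult_left_mono) auto
    also have "\<dots> = t * (\<epsilon> * B)" by simp
    also have "\<dots> = t * \<rho> / 12" by (simp add: \<epsilon>)
    finally show ?thesis using y by (intro bexI[of _ y]) auto
  qed
  obtain x1 where x1: "x1 \<in> A" "norm (x + t *\<^sub>R v - x1) \<le> t * \<rho> / 12"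
    using reach[OF v(1) B(2)] by blast
  have close: "norm (x + t *\<^sub>R v - y) \<le> t * \<rho> / 6" if "dist x1 y < t * \<rho> / 12" for y
    using x1(2) that norm_triangle_ineq[of "x + t *\<^sub>R v - x1" "x1 - y"] by (simp add: dist_norm)
  have inU: "y \<in> U" if "dist x1 y < t * \<rho> / 12" for y
  proof -
    have "norm (y - x) \<le> norm (t *\<^sub>R v) + norm (x + t *\<^sub>R v - y)"
      using norm_triangle_ineq4[of "t *\<^sub>R v" "x + t *\<^sub>R v - y"] by simp
    also have "\<dots> \<le> t * norm v + t * \<rho>"
      using close[OF that] t0 t\<rho> by simp
    also have "\<dots> = t * B" by (simp add: B_def distrib_left)
    finally have "dist x y < \<eta>" using tB by (simp add: dist_norm norm_minus_commute)
    then show ?thesis using \<eta> by auto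
  qed
  show ?thesis
  proof (rule that[OF L Q x1(1)])
    show "x1 \<in> U" using inU[of x1] t\<rho> by simp
    show "0 < t * \<rho> / 12" using t\<rho> by simp
    fix y assume y: "y \<in> A" "dist x1 y < t * \<rho> / 12"
    have "dim (?T y) \<le> dim L"
      using max[of y] y inU by (simp add: L_def)
    moreover have "\<exists>u\<in>?T y. norm (u - e) \<le> 1/3" if e: "e \<in> L" "norm e = 1" for e
    proof -
      have "v + \<rho> *\<^sub>R e \<in> cball v \<rho> \<inter> L"
        using vL e v(2) L by (auto simp: dist_norm subspace_add subspace_scale)
      then have "v + \<rho> *\<^sub>R e \<in> ?T x" using v(3) by blast
      moreover have "norm (v + \<rho> *\<^sub>R e) \<le> B"
        using norm_triangle_ineq[of v "\<rho> *\<^sub>R e"] e v(2) by (simp add: B_def)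
      ultimately obtain b where b: "b \<in> A" "norm (x + t *\<^sub>R (v + \<rho> *\<^sub>R e) - b) \<le> t * \<rho> / 12"
        using reach by blast
      \<comment> \<open>Error budget relative to \<open>s\<close>: \<open>1/6\<close> for
        \<open>y\<close>, \<open>1/12\<close> for \<open>b\<close> and \<open>1/12\<close> for
        replacing \<open>b - y\<close> by a tangent vector, in total \<open>1/3\<close>. The last
        share uses \<open>s \<le> R / 20\<close>.\<close>
      define s where "s = t * \<rho>"
      have s: "0 < s" "s \<le> R / 20" using t\<rho> by (auto simp: s_def)
      have "b - y - s *\<^sub>R e = (x + t *\<^sub>R v - y) - (x + t *\<^sub>R (v + \<rho> *\<^sub>R e) - b)"
        by (simp add: s_def scaleR_add_right)
      then have "norm (b - y - s *\<^sub>R e) \<le> norm (x + t *\<^sub>R v - y) + norm (x + t *\<^sub>R (v + \<rho> *\<^sub>R e) - b)"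
        by (simp only: norm_triangle_ineq4)
      then have n1: "norm (b - y - s *\<^sub>R e) \<le> s / 4"
        using b(2) close[OF y(2)] by (simp add: s_def)
      have n2: "norm (b - y) \<le> 5 / 4 * s"
        using norm_triangle_ineq[of "b - y - s *\<^sub>R e" "s *\<^sub>R e"] n1 e s by simp
      obtain u where u: "u \<in> ?T y" "norm (b - y - u) \<le> (norm (b - y))\<^sup>2 / R"
        using tangent_approximation[OF y(1) b(1)] by blast
      have "(norm (b - y))\<^sup>2 \<le> (5 / 4 * s)\<^sup>2"
        using n2 by (intro power_mono) auto
      also have "\<dots> = 25 / 16 * s * s" by (simp add: power2_eq_square)
      also have "\<dots> \<le> 25 / 16 * (R / 20) * s"
        using s by (intro mult_right_mono) auto
      also have "\<dots> \<le> R * (s / 12)"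
        using s R_pos by simp
      finally have "(norm (b - y))\<^sup>2 / R \<le> s / 12"
        using R_pos by (simp add: field_simps)
      then have "norm (b - y - u) \<le> s / 12"
        using u(2) by linarith
      then have "norm (u - s *\<^sub>R e) \<le> s / 3"
        using n1 norm_triangle_ineq4[of "b - y - s *\<^sub>R e" "b - y - u"] by simp
      moreover have "u - s *\<^sub>R e = s *\<^sub>R ((1 / s) *\<^sub>R u - e)"
        using s by (simp add: scaleR_diff_right)
      ultimately have "s * norm ((1 / s) *\<^sub>R u - e) \<le> s * (1/3)"
        using s by simp
      then have "norm ((1 / s) *\<^sub>R u - e) \<le> 1/3"
        using s by (simp only: mult_le_cancel_left_pos)
      moreover have "(1 / s) *\<^sub>R u \<in> ?T y"
        using u(1) s by (intro tangent_cone_scaleR) auto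
      ultimately show ?thesis by blast
    qed
    ultimately show "\<exists>h. projects_onto Q L (?T y) h"
      using cone_near_subspace_projects_onto[OF convex_tangent_cone cone_tangent_cone
          closed_tangent_cone tangent_cone_zero L _ _ Q]
      by metis
  qed
qed

text \<open>A tangent vector \<open>u\<close> approximates \<open>b - a\<close> and satisfies
  \<open>norm u \<le> 2 * norm (Q u)\<close>. Since \<open>b\<close> is within \<open>R / 8\<close>,
  the error is at most an eighth of \<open>norm (b - a)\<close> and can be absorbed. Replacing
  \<open>u\<close> by \<open>h (Q b - Q a)\<close> triples the quadratic error, and
  \<open>3 * 4\<^sup>2 = 48\<close>.\<close>

lemma flat_region_bilipschitz:
  assumes L: "subspace L" and Q: "orth_proj L Q"
    and a: "a \<in> A" "projects_onto Q L (tangent_cone A a) h" and b: "b \<in> A" "dist a b \<le> R / 8"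
  shows "norm (b - a) \<le> 4 * norm (Q b - Q a)"
    and "norm (b - a - h (Q b - Q a)) \<le> 48 / R * (norm (Q b - Q a))\<^sup>2"
proof -
  note Qd = orth_proj_diff[OF Q L] and Qn = orth_proj_norm_le[OF Q L]
  have h: "linear h" "\<And>w. w \<in> L \<Longrightarrow> norm (h w) \<le> 2 * norm w" "\<And>u. u \<in> tangent_cone A a \<Longrightarrow> h (Q u) = u"
    using a(2) by (auto simp: projects_onto_def)
  obtain u where u: "u \<in> tangent_cone A a" "norm (b - a - u) \<le> (norm (b - a))\<^sup>2 / R"
    using tangent_approximation[OF a(1) b(1)] by blast
  have nu: "norm u \<le> 2 * norm (Q u)"
    using h(2)[OF orth_proj_in[OF Q L], of u] h(3)[OF u(1)] by simp
  have "norm (b - a) * norm (b - a) \<le> R / 8 * norm (b - a)"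
    using b(2) by (intro mult_right_mono) (auto simp: dist_norm norm_minus_commute)
  then have "(norm (b - a))\<^sup>2 / R \<le> norm (b - a) / 8"
    using R_pos by (simp add: power2_eq_square field_simps)
  then have d: "norm (b - a - u) \<le> norm (b - a) / 8"
    using u(2) by linarith
  have "norm (Q (b - a - u)) \<le> norm (b - a - u)" by (rule Qn)
  then have Qbu: "norm (Q b - Q a - Q u) \<le> norm (b - a - u)" by (simp add: Qd)
  have "norm (b - a) \<le> norm u + norm (b - a - u)"
    using norm_triangle_ineq[of u "b - a - u"] by simp
  moreover have "norm (Q u) \<le> norm (Q b - Q a) + norm (Q b - Q a - Q u)"
    using norm_triangle_ineq4[of "Q b - Q a" "Q b - Q a - Q u"] by simp
  ultimately show lip: "norm (b - a) \<le> 4 * norm (Q b - Q a)"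
    using nu d Qbu norm_ge_zero[of "Q b - Q a"] by linarith
  have "h (Q b - Q a) - u = h (Q b - Q a - Q u)"
    using linear_diff[OF h(1)] h(3)[OF u(1)] by metis
  moreover have "Q b - Q a - Q u \<in> L"
    using L by (intro subspace_diff orth_proj_in[OF Q L])
  ultimately have "norm (h (Q b - Q a) - u) \<le> 2 * norm (b - a - u)"
    using h(2) Qbu by fastforce
  moreover have "norm (b - a - h (Q b - Q a)) \<le> norm (b - a - u) + norm (h (Q b - Q a) - u)"
    using norm_triangle_ineq4[of "b - a - u" "h (Q b - Q a) - u"] by simp
  ultimately have "norm (b - a - h (Q b - Q a)) \<le> 3 * ((norm (b - a))\<^sup>2 / R)"
    using u(2) by linarith
  also have "\<dots> \<le> 3 * ((4 * norm (Q b - Q a))\<^sup>2 / R)"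
    using lip R_pos by (intro mult_left_mono divide_right_mono power_mono) auto
  also have "\<dots> = 48 / R * (norm (Q b - Q a))\<^sup>2"
    by (simp add: power_mult_distrib)
  finally show "norm (b - a - h (Q b - Q a)) \<le> 48 / R * (norm (Q b - Q a))\<^sup>2" .
qed

text \<open>If \<open>w\<close> were missed, then from the point \<open>y\<close> of \<open>A\<close> whose projection is nearest to \<open>w\<close> one could
  move inside \<open>A\<close> along the tangent vector over \<open>w - Q y\<close> and get closer.\<close>

lemma flat_region_covers:
  assumes L: "subspace L" and Q: "orth_proj L Q" and x: "x \<in> A" and \<tau>: "0 < \<tau>" "\<tau> \<le> R / 8"
    and flat: "\<And>y. y \<in> A \<Longrightarrow> dist x y < \<tau> \<Longrightarrow> \<exists>h. projects_onto Q L (tangent_cone A y) h"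
    and w: "w \<in> L" "dist (Q x) w < \<tau> / 32"
  obtains y where "y \<in> A" "dist x y < \<tau> / 2" "Q y = w"
proof -
  note Qd = orth_proj_diff[OF Q L] and Qn = orth_proj_norm_le[OF Q L]
  note Qadd = linear_add[OF orth_proj_linear[OF Q L]]
  define K where "K = A \<inter> cball x (\<tau> / 2)"
  have "bounded_linear Q"
    using orth_proj_linear[OF Q L] linear_conv_bounded_linear by blast
  then have "continuous_on K (\<lambda>y. dist (Q y) w)"
    by (intro continuous_intros linear_continuous_on)
  moreover have "compact K" "x \<in> K"
    using closed_A x \<tau> by (auto simp: K_def closed_Int_compact)
  ultimately obtain y where y: "y \<in> K" "\<And>z. z \<in> K \<Longrightarrow> dist (Q y) w \<le> dist (Q z) w"
    using continuous_attains_inf[of K "\<lambda>y. dist (Q y) w"] by blast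
  have yA: "y \<in> A" "dist x y \<le> \<tau> / 2" using y(1) by (auto simp: K_def)
  obtain hx where hx: "projects_onto Q L (tangent_cone A x) hx"
    using flat[OF x] \<tau> by auto
  \<comment> \<open>The minimizer stays away from the boundary of \<open>K\<close>: its projection
    is within \<open>\<tau> / 16\<close> of \<open>Q x\<close>, hence it is itself within
    \<open>\<tau> / 4\<close> of \<open>x\<close>.\<close>
  have "norm (y - x) \<le> 4 * norm (Q y - Q x)"
    using flat_region_bilipschitz(1)[OF L Q x hx yA(1)] yA(2) \<tau> by simp
  moreover have "norm (Q y - Q x) \<le> dist (Q y) w + dist (Q x) w"
    using dist_triangle2[of "Q y" "Q x" w] by (simp add: dist_norm)
  moreover have "dist (Q y) w \<le> dist (Q x) w" using y(2) \<open>x \<in> K\<close> by blast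
  ultimately have yx: "dist x y < \<tau> / 4"
    using w(2) by (simp add: dist_norm norm_minus_commute)
  have "Q y = w"
  proof (rule ccontr)
    assume ne: "Q y \<noteq> w"
    define d where "d = norm (w - Q y)"
    have d: "0 < d" using ne by (simp add: d_def)
    obtain h where h: "projects_onto Q L (tangent_cone A y) h"
      using flat[OF yA(1)] yx \<tau> by auto
    define u where "u = h (w - Q y)"
    have "w - Q y \<in> L" using w L orth_proj_in[OF Q L] by (simp add: subspace_diff)
    then have u: "u \<in> tangent_cone A y" "Q u = w - Q y" "norm u \<le> 2 * d"
      using h by (auto simp: projects_onto_def u_def d_def)
    obtain \<delta> where \<delta>: "0 < \<delta>" "\<And>u. u \<in> tangent_cone A y \<Longrightarrow> norm u < \<delta> \<Longrightarrow>
        \<exists>z\<in>A. norm (y + u - z) \<le> 1/4 * norm u"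
      using tangent_vectors_realized[OF yA(1), of "1/4"] by auto
    \<comment> \<open>Short enough for \<open>t *\<^sub>R u\<close> to be realized by a point
      \<open>z\<close> of \<open>A\<close> that still lies in \<open>K\<close>.\<close>
    define t where "t = min 1 (min \<delta> (\<tau> / 8) / (4 * d))"
    have m: "0 < min \<delta> (\<tau> / 8)" using \<delta> \<tau> by simp
    have t: "0 < t" "t \<le> 1" using m d by (auto simp: t_def)
    have "t \<le> min \<delta> (\<tau> / 8) / (4 * d)" by (simp add: t_def)
    then have "t * (2 * d) \<le> min \<delta> (\<tau> / 8) / 2" using d by (simp add: field_simps)
    moreover have ntu: "norm (t *\<^sub>R u) \<le> t * (2 * d)" using u(3) t by simp
    ultimately have tu: "norm (t *\<^sub>R u) < \<delta>" "norm (t *\<^sub>R u) < \<tau> / 8"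
      using m by linarith+
    obtain z where z: "z \<in> A" "norm (y + t *\<^sub>R u - z) \<le> 1/4 * norm (t *\<^sub>R u)"
      using \<delta>(2)[OF tangent_cone_scaleR[OF u(1) less_imp_le[OF t(1)]] tu(1)] by blast
    have "norm (z - y) \<le> norm (t *\<^sub>R u) + norm (y + t *\<^sub>R u - z)"
      using norm_triangle_ineq4[of "t *\<^sub>R u" "y + t *\<^sub>R u - z"] by simp
    then have "dist y z \<le> \<tau> / 4"
      using z(2) tu \<tau>(1) by (simp add: dist_norm norm_minus_commute[of y])
    then have "dist x z \<le> \<tau> / 2"
      using yx dist_triangle[of x z y] by simp
    then have "d \<le> norm (w - Q z)"
      using y(2)[of z] z(1) by (simp add: K_def d_def dist_norm norm_minus_commute)
    \<comment> \<open>The move gains \<open>t * d\<close> and the realization error costs at most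
      half of that, contradicting minimality of \<open>d\<close>.\<close>
    also have "w - Q z = Q (y + t *\<^sub>R u - z) + (1 - t) *\<^sub>R (w - Q y)"
      by (simp add: Qd Qadd linear_scale[OF orth_proj_linear[OF Q L]] u(2) algebra_simps)
    also have "norm \<dots> \<le> norm (Q (y + t *\<^sub>R u - z)) + norm ((1 - t) *\<^sub>R (w - Q y))"
      by (rule norm_triangle_ineq)
    also have "\<dots> \<le> 1/4 * (t * (2 * d)) + (1 - t) * d"
    proof (rule add_mono)
      show "norm (Q (y + t *\<^sub>R u - z)) \<le> 1/4 * (t * (2 * d))"
        using Qn[of "y + t *\<^sub>R u - z"] z(2) ntu by linarith
      show "norm ((1 - t) *\<^sub>R (w - Q y)) \<le> (1 - t) * d"
        using t by (simp add: d_def)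
    qed
    finally have "t * d \<le> 0"
      by (simp add: algebra_simps)
    then show False using t d by (simp add: mult_le_0_iff)
  qed
  then show ?thesis using that[OF yA(1)] yx \<tau> by simp
qed

text \<open>Near \<open>x\<close> the map \<open>Q\<close> is injective on \<open>A\<close> by the
  bilipschitz bound and covers a ball of \<open>L\<close>. Its inverse \<open>g\<close> gives
  \<open>\<phi> w = g w - w\<close>, with derivative \<open>h (g w) v - v\<close> in direction
  \<open>v\<close>; the second bilipschitz estimate is the quadratic remainder bound that
  \<open>C11_onI_quadratic\<close> asks for.\<close>

lemma flat_region_graph:
  assumes L: "subspace L" and Q: "orth_proj L Q" and x: "x \<in> A" and \<tau>0: "0 < \<tau>0"
    and flat0: "\<And>y. y \<in> A \<Longrightarrow> dist x y < \<tau>0 \<Longrightarrow> \<exists>h. projects_onto Q L (tangent_cone A y) h"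
  shows "\<exists>r \<phi>. 0 < r \<and> (\<forall>w \<in> L \<inter> ball (Q x) r. \<phi> w \<in> L\<^sup>\<bottom>) \<and>
    C11_on L (L \<inter> ball (Q x) r) \<phi> \<and>
    openin (top_of_set A) ((\<lambda>w. w + \<phi> w) ` (L \<inter> ball (Q x) r)) \<and>
    x \<in> (\<lambda>w. w + \<phi> w) ` (L \<inter> ball (Q x) r)"
proof -
  define \<tau> where "\<tau> = min \<tau>0 (R / 8)"
  have \<tau>: "0 < \<tau>" "\<tau> \<le> R / 8" using \<tau>0 R_pos by (auto simp: \<tau>_def)
  \<comment> \<open>A third of the covering radius \<open>\<tau> / 32\<close>, as
    \<open>C11_onI_quadratic\<close> works on the ball of radius \<open>3 * r\<close>.\<close>
  define r where "r = \<tau> / 96"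
  have r: "0 < r" "3 * r = \<tau> / 32" using \<tau> by (auto simp: r_def)
  define D where "D = A \<inter> ball x (\<tau> / 2)"
  have "\<exists>h. projects_onto Q L (tangent_cone A y) h" if "y \<in> A" "dist x y < \<tau>" for y
    using flat0 that by (simp add: \<tau>_def)
  note flat = this
  have "\<exists>y\<in>D. Q y = w" if "w \<in> L \<inter> ball (Q x) (3 * r)" for w
  proof -
    have "w \<in> L" "dist (Q x) w < \<tau> / 32" using that r by auto
    then obtain y where "y \<in> A" "dist x y < \<tau> / 2" "Q y = w"
      using flat_region_covers[OF L Q x \<tau> flat] by metis
    then show ?thesis by (auto simp: D_def)
  qed
  then obtain g where g: "\<And>w. w \<in> L \<inter> ball (Q x) (3 * r) \<Longrightarrow> g w \<in> D \<and> Q (g w) = w"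
    by metis
  have "\<exists>h. projects_onto Q L (tangent_cone A y) h" if "y \<in> D" for y
    using flat[of y] that \<tau> by (auto simp: D_def)
  then obtain h where h: "\<And>y. y \<in> D \<Longrightarrow> projects_onto Q L (tangent_cone A y) (h y)"
    by metis
  have est: "norm (b - a) \<le> 4 * norm (Q b - Q a)"
      "norm (b - a - h a (Q b - Q a)) \<le> 48 / R * (norm (Q b - Q a))\<^sup>2" if "a \<in> D" "b \<in> D" for a b
  proof -
    have ab: "a \<in> A" "b \<in> A" "dist a b \<le> R / 8"
      using that \<tau> dist_triangle3[of a b x] by (auto simp: D_def)
    then show "norm (b - a) \<le> 4 * norm (Q b - Q a)"
      "norm (b - a - h a (Q b - Q a)) \<le> 48 / R * (norm (Q b - Q a))\<^sup>2"
      using flat_region_bilipschitz[OF L Q ab(1) h[OF that(1)] ab(2,3)] by auto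
  qed
  have gQ: "g (Q y) = y" if "y \<in> D" "Q y \<in> ball (Q x) (3 * r)" for y
    using est(1)[of y "g (Q y)"] g[of "Q y"] orth_proj_in[OF Q L, of y] that by simp
  define \<phi> where "\<phi> w = g w - w" for w
  have sub: "w \<in> L \<inter> ball (Q x) (3 * r)" if "w \<in> L \<inter> ball (Q x) r" for w
    using that r by auto
  \<comment> \<open>In this form the graph is visibly relatively open in \<open>A\<close>, as
    \<open>Q\<close> is continuous.\<close>
  have img: "(\<lambda>w. w + \<phi> w) ` (L \<inter> ball (Q x) r) = D \<inter> Q -` ball (Q x) r"
  proof (intro set_eqI iffI)
    fix y assume "y \<in> (\<lambda>w. w + \<phi> w) ` (L \<inter> ball (Q x) r)"
    then obtain w where w: "w \<in> L \<inter> ball (Q x) r" "y = g w"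
      by (auto simp: \<phi>_def)
    then show "y \<in> D \<inter> Q -` ball (Q x) r"
      using g[OF sub[OF w(1)]] by simp
  next
    fix y assume y: "y \<in> D \<inter> Q -` ball (Q x) r"
    then have "Q y \<in> L \<inter> ball (Q x) r" "g (Q y) = y"
      using orth_proj_in[OF Q L] sub[of "Q y"] gQ[of y] by auto
    then show "y \<in> (\<lambda>w. w + \<phi> w) ` (L \<inter> ball (Q x) r)"
      by (intro image_eqI[of _ _ "Q y"]) (auto simp: \<phi>_def)
  qed
  have "bounded_linear Q"
    using orth_proj_linear[OF Q L] linear_conv_bounded_linear by blast
  then have "open (Q -` ball (Q x) r)"
    by (intro open_vimage linear_continuous_on) auto
  then have "openin (top_of_set A) (A \<inter> (ball x (\<tau> / 2) \<inter> Q -` ball (Q x) r))"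
    by (intro openin_open_Int open_Int) auto
  then have op: "openin (top_of_set A) ((\<lambda>w. w + \<phi> w) ` (L \<inter> ball (Q x) r))"
    unfolding img D_def by (simp add: Int_assoc)
  have "C11_on L (L \<inter> ball (Q x) r) \<phi>"
  proof (rule C11_onI_quadratic[OF L, of "48 / R" _ _ "\<lambda>w v. h (g w) v - v"])
    show "0 \<le> 48 / R" using R_pos by simp
    show "linear (\<lambda>v. h (g u) v - v)" if "u \<in> L \<inter> ball (Q x) (3 * r)" for u
      using h[of "g u"] g[OF that] by (intro linear_compose_sub linear_ident) (auto simp: projects_onto_def)
    fix u v assume uv: "u \<in> L \<inter> ball (Q x) (3 * r)" "v \<in> L \<inter> ball (Q x) (3 * r)"
    show "norm (\<phi> v - \<phi> u - (h (g u) (v - u) - (v - u))) \<le> 48 / R * (norm (v - u))\<^sup>2"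
      using est(2)[of "g u" "g v"] g[OF uv(1)] g[OF uv(2)] by (simp add: \<phi>_def)
  qed
  moreover have "\<phi> w \<in> L\<^sup>\<bottom>" if "w \<in> L \<inter> ball (Q x) r" for w
  proof (rule orth_proj_eq_0D[OF Q L])
    show "Q (\<phi> w) = 0"
      using g[OF sub[OF that]] that orth_proj_id[OF Q L]
      by (simp add: \<phi>_def orth_proj_diff[OF Q L])
  qed
  moreover have "x \<in> (\<lambda>w. w + \<phi> w) ` (L \<inter> ball (Q x) r)"
    unfolding img using x \<tau> r by (simp add: D_def)
  ultimately show ?thesis
    using r(1) op by blast
qed

text \<open>One graph serves as a chart at all of its points. The extreme dimensions follow their
  own definitions: for \<open>dim L = 0\<close> the graph is at most one point, and for full
  dimension \<open>\<phi>\<close> vanishes and the graph is a ball.\<close>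

lemma smooth_point_exists:
  assumes U: "open U" "A \<inter> U \<noteq> {}"
  obtains x k where "x \<in> U" "k \<le> DIM('a)" "x \<in> smooth_points k A"
proof -
  obtain L Q x \<tau> where L: "subspace L" and Q: "orth_proj L Q" and x: "x \<in> A" "x \<in> U" and \<tau>: "0 < \<tau>"
    and flat: "\<And>y. y \<in> A \<Longrightarrow> dist x y < \<tau> \<Longrightarrow> \<exists>h. projects_onto Q L (tangent_cone A y) h"
    using flat_region_exists[OF U] by metis
  obtain r \<phi> where r: "0 < r" "\<And>w. w \<in> L \<inter> ball (Q x) r \<Longrightarrow> \<phi> w \<in> L\<^sup>\<bottom>"
    "C11_on L (L \<inter> ball (Q x) r) \<phi>"
    "openin (top_of_set A) ((\<lambda>w. w + \<phi> w) ` (L \<inter> ball (Q x) r))"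
    "x \<in> (\<lambda>w. w + \<phi> w) ` (L \<inter> ball (Q x) r)"
    using flat_region_graph[OF L Q x(1) \<tau> flat] by blast
  let ?M = "(\<lambda>w. w + \<phi> w) ` (L \<inter> ball (Q x) r)"
  consider "dim L = 0" | "dim L \<noteq> 0" "dim L = DIM('a)" | "dim L \<noteq> 0" "dim L \<noteq> DIM('a)" by blast
  then have "C11_manifold (dim L) ?M"
  proof cases
    case 1
    then have "L \<subseteq> {0}" by (simp only: dim_eq_0)
    then have "?M \<subseteq> {0 + \<phi> 0}" by auto
    then have "finite ?M" using finite_subset by blast
    then have "discrete ?M" using discrete_compact_finite_iff by blast
    then show ?thesis using 1 by (simp add: C11_manifold_def)
  next
    case 2
    then have LU: "L = UNIV" using L dim_eq_full span_eq_iff by metis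
    then have "\<phi> w = 0" if "w \<in> ball (Q x) r" for w
      using r(2)[of w] that by (simp add: orthogonal_comp_UNIV)
    then have "?M = ball (Q x) r" using LU by auto
    then show ?thesis using 2 r(1) by (simp add: C11_manifold_def)
  next
    case 3
    have "C11_chart (dim L) ?M a" if "a \<in> ?M" for a
      unfolding C11_chart_def
      by (intro exI[of _ L] exI[of _ "Q x"] exI[of _ r] exI[of _ \<phi>] conjI ballI
          L refl orth_proj_in[OF Q L] r(1-3) that openin_subtopology_self)
    then show ?thesis
      using r(5) unfolding C11_manifold_iff_chart[OF 3] by blast
  qed
  then have "x \<in> smooth_points (dim L) A"
    using smooth_pointsI_openin[OF _ r(4,5)] by blast
  then show ?thesis
    using that x dim_subset_UNIV by blast
qed

end

text \<open>The reach may be infinite, so a real \<open>R\<close> strictly between \<open>0\<close>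
  and \<open>reach A\<close> is chosen. A point closer than \<open>R\<close> to \<open>A\<close> is
  within \<open>R\<close> of some \<open>a\<close> in \<open>A\<close>, and some ball about
  \<open>a\<close> of radius above \<open>R\<close> lies in \<open>Unp A\<close>.\<close>

lemma positive_reach_imp_unp_tube:
  assumes "positive_reach A"
  obtains R where "unp_tube A R"
proof -
  have A: "A \<noteq> {}" "0 < reach A" using assms by (auto simp: positive_reach_def)
  obtain R where R: "0 < ereal R" "ereal R < reach A"
    using ereal_dense2[OF A(2)] by blast
  have "z \<in> Unp A" if "infdist z A < R" for z
  proof -
    have "(INF a\<in>A. dist z a) < R" using that A by (simp add: infdist_notempty)
    then obtain a where a: "a \<in> A" "dist z a < R"
      using cINF_less_iff[OF A(1) bdd_belowI2[of A 0 "dist z"]] by auto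
    have "ereal R < reach_at A a"
      using R(2) a(1) unfolding reach_def by (meson INF_lower less_le_trans)
    then obtain r where "ereal R < ereal r" "ball a r \<subseteq> Unp A"
      unfolding reach_at_def less_Sup_iff by blast
    then show ?thesis using a by (force simp: dist_commute)
  qed
  then have "unp_tube A R"
    using A R by unfold_locales auto
  then show ?thesis using that by blast
qed

theorem corollary7p10:
  fixes A :: "'a::euclidean_space set"
  assumes "positive_reach A"
  defines "S \<equiv> (\<Union>k\<in>{0..DIM('a)}. smooth_points k A)"
  shows "openin (top_of_set A) S \<and> A \<subseteq> closure S"
proof
  show "openin (top_of_set A) S"
    unfolding S_def by (intro openin_Union) (auto intro: openin_smooth_points)
  obtain R where "unp_tube A R" using positive_reach_imp_unp_tube assms(1) by blast
  then interpret unp_tube A R .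
  show "A \<subseteq> closure S"
  proof
    fix a assume a: "a \<in> A"
    show "a \<in> closure S"
      unfolding closure_approachable
    proof (intro allI impI)
      fix e :: real assume "0 < e"
      then have "A \<inter> ball a e \<noteq> {}" using a by auto
      then obtain x k where "x \<in> ball a e" "k \<le> DIM('a)" "x \<in> smooth_points k A"
        using smooth_point_exists[OF open_ball] by metis
      then show "\<exists>y\<in>S. dist y a < e"
        by (auto simp: S_def dist_commute intro!: bexI[of _ x])
    qed
  qed
qed

end
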